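(* Let $A$ be a bounded band operator on $\ell^2(\mathbb{N})$, in its block-tridiagonal representation on $\ell^2(\mathbb{N},\mathbb{C}^d)$ with sub- and superdiagonals $\alpha,\gamma$, and for $n\in\mathbb{N}$ let $$\varepsilon_n = 2(\|\alpha\|_\infty+\|\gamma\|_\infty)\sin\frac{\pi}{2(n+1)}.$$ Then for all $\varepsilon>0$ and $n\in\mathbb{N}$, $$\bigcup_{k\in\mathbb{N}_0}\mathrm{spec}_{\varepsilon}(AP_{n,k},A^*P_{n,k})\ \subseteq\ \mathrm{spec}_\varepsilon A\ \subseteq\ \bigcup_{k\in\mathbb{N}_0}\mathrm{spec}_{\varepsilon+\varepsilon_n}(AP_{n,k},A^*P_{n,k}).$$ Moreover, for each $\varepsilon>0$, both the subsets (left-hand sides) and the supersets (right-hand sides) converge to $\mathrm{spec}_\varepsilon A$ in the Hausdorff distance as $n\to\infty$.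
   Context: $\mathbb{N}=\{1,2,\dots\}$ and $\mathbb{N}_0=\{0,1,2,\dots\}$. Band operator: a bounded linear operator on $\ell^2(\mathbb{N})$ (complex sequences, Euclidean norm) given by a semi-infinite matrix $(A_{i,j})_{i,j\in\mathbb{N}}$ with finite bandwidth $b$, where $b$ is the largest $|i-j|$ over all positions with $A_{i,j}\neq 0$; each diagonal is a bounded sequence. Block-tridiagonal representation: if $b\le 1$ put $d=1$; if $b>1$ put $d=b+1$ and group the indices in $\mathbb{N}$ into consecutive blocks of length $d$ (starting with $\{1,\dots,d\}$), identifying $\ell^2(\mathbb{N})$ with $\ell^2(\mathbb{N},\mathbb{C}^d)$. Then $A$ is a tridiagonal matrix whose entries $A_{i,j}$ are $d\times d$ complex matrices (scalars if $d=1$). From here on, all indices, columns and supports refer to this representation. Put $\alpha_i=A_{i+1,i}$ ($i\ge 1$), $\gamma_i=A_{i-1,i}$ ($i\ge 2$), $\|\alpha\|_\infty=\sup_i\|\alpha_i\|$, $\|\gamma\|_\infty=\sup_i\|\gamma_i\|$, with the operator norm induced by the Euclidean norm on $\mathbb{C}^d$. $A^*$ denotes the Banach space adjoint (the transpose matrix, without complex conjugation), so $(\lambda I)^*=\lambda I$. Lower norm: $\nu(B)=\inf\{\|Bx\|:\|x\|=1\}$, the infimum being over $x$ in the domain space of $B$. Pseudospectrum: $\mathrm{spec}_\varepsilon A=\{\lambda\in\mathbb{C}:\|(A-\lambda I)^{-1}\|>1/\varepsilon\}$ for $\varepsilon>0$, with $\|B^{-1}\|:=\infty$ if $B$ is not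 invertible. For $n\in\mathbb{N}$ and $k\in\mathbb{N}_0$, $BP_{n,k}$ denotes the restriction of $B$ to the sequences supported in $k+\{1,\dots,n\}$, i.e. the matrix formed by columns $k+1,\dots,k+n$ of $B$. For $B=A$ or $B=A^*$, $\mathrm{spec}_\varepsilon(BP_{n,k}):=\{\lambda\in\mathbb{C}:\nu((B-\lambda I)P_{n,k})<\varepsilon\}$. Finally $\mathrm{spec}_\varepsilon(AP_{n,k},A^*P_{n,k}):=\mathrm{spec}_\varepsilon(AP_{n,k})\cup\mathrm{spec}_\varepsilon(A^*P_{n,k})$. Hausdorff distance of nonempty bounded sets $S,T\subset\mathbb{C}$ (not necessarily closed): $\max\{\sup_{s\in S}\mathrm{dist}(s,T),\sup_{t\in T}\mathrm{dist}(t,S)\}$. Finitely many initial terms of the sequence of subsets may be empty; convergence concerns large $n$. *)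

theory Defs
  imports "HOL-Analysis.Analysis"
begin

text \<open>
  Sequences, matrices and blocks are indexed from 0, so index \<open>i\<close> here is index \<open>i + 1\<close>
  of the usual \<open>\<nat> = {1, 2, \<dots>}\<close> convention.
\<close>

section \<open>The space of square-summable complex sequences\<close>

typedef ell2 = "{x :: nat \<Rightarrow> complex. summable (\<lambda>i. (cmod (x i))\<^sup>2)}"
  morphisms coord Abs_ell2
  by (rule exI[of _ "\<lambda>_. 0"]) simp

setup_lifting type_definition_ell2

lemma square_summable_add:
  fixes x y :: "nat \<Rightarrow> complex"
  assumes "summable (\<lambda>i. (cmod (x i))\<^sup>2)" "summable (\<lambda>i. (cmod (y i))\<^sup>2)"
  shows "summable (\<lambda>i. (cmod (x i + y i))\<^sup>2)"
proof (rule summable_comparison_test')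
  show "summable (\<lambda>i. 2 * (cmod (x i))\<^sup>2 + 2 * (cmod (y i))\<^sup>2)"
    by (intro summable_add summable_mult assms)
  fix i :: nat
  have "(cmod (x i + y i))\<^sup>2 \<le> (cmod (x i) + cmod (y i))\<^sup>2"
    by (intro power_mono norm_triangle_ineq norm_ge_zero)
  also have "\<dots> \<le> 2 * (cmod (x i))\<^sup>2 + 2 * (cmod (y i))\<^sup>2"
    using sum_squares_bound[of "cmod (x i)" "cmod (y i)"] by (simp add: power2_sum)
  finally show "norm ((cmod (x i + y i))\<^sup>2) \<le> 2 * (cmod (x i))\<^sup>2 + 2 * (cmod (y i))\<^sup>2"
    by simp
qed

lemma square_summable_mult:
  fixes x :: "nat \<Rightarrow> complex"
  assumes "summable (\<lambda>i. (cmod (x i))\<^sup>2)"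
  shows "summable (\<lambda>i. (cmod (c * x i))\<^sup>2)"
  using summable_mult[OF assms, of "(cmod c)\<^sup>2"] by (simp add: norm_mult power_mult_distrib)

lemma summable_coord: "summable (\<lambda>i. (cmod (coord x i))\<^sup>2)"
  using coord[of x] by simp

lift_definition cscale :: "complex \<Rightarrow> ell2 \<Rightarrow> ell2" is "\<lambda>c x i. c * x i"
  by (rule square_summable_mult)

lift_definition unit_seq :: "nat \<Rightarrow> ell2" is "\<lambda>j i. if i = j then 1 else 0"
  by (rule summable_finite[of "{_}"]) auto

instantiation ell2 :: real_vector
begin

lift_definition zero_ell2 :: ell2 is "\<lambda>_. 0" by simp
lift_definition plus_ell2 :: "ell2 \<Rightarrow> ell2 \<Rightarrow> ell2" is "\<lambda>x y i. x i + y i"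
  by (rule square_summable_add)
lift_definition uminus_ell2 :: "ell2 \<Rightarrow> ell2" is "\<lambda>x i. - x i" by simp
lift_definition minus_ell2 :: "ell2 \<Rightarrow> ell2 \<Rightarrow> ell2" is "\<lambda>x y i. x i - y i"
  by (drule (1) square_summable_add[where y = "\<lambda>i. - _ i", simplified])
     (simp_all add: square_summable_add[where y = "\<lambda>i. - _ i", simplified])
lift_definition scaleR_ell2 :: "real \<Rightarrow> ell2 \<Rightarrow> ell2" is "\<lambda>r x i. r *\<^sub>R x i"
  using square_summable_mult by (simp add: scaleR_conv_of_real)

instance
  by standard (transfer; simp add: fun_eq_iff algebra_simps)+

end

instantiation ell2 :: real_normed_vector
begin

definition norm_ell2 :: "ell2 \<Rightarrow> real" where
  "norm_ell2 x = sqrt (\<Sum>i. (cmod (coord x i))\<^sup>2)"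
definition dist_ell2 :: "ell2 \<Rightarrow> ell2 \<Rightarrow> real" where
  "dist_ell2 x y = norm (x - y)"
definition sgn_ell2 :: "ell2 \<Rightarrow> ell2" where
  "sgn_ell2 x = inverse (norm x) *\<^sub>R x"
definition uniformity_ell2 :: "(ell2 \<times> ell2) filter" where
  "uniformity_ell2 = (INF e\<in>{0<..}. principal {(x, y). dist x y < e})"
definition open_ell2 :: "ell2 set \<Rightarrow> bool" where
  "open_ell2 U \<longleftrightarrow> (\<forall>x\<in>U. eventually (\<lambda>(x', y). x' = x \<longrightarrow> y \<in> U) uniformity)"

instance
proof
  fix x y :: ell2 and r :: real
  show "dist x y = norm (x - y)" "sgn x = inverse (norm x) *\<^sub>R x"
    by (simp_all add: dist_ell2_def sgn_ell2_def)
  show "(uniformity :: (ell2 \<times> ell2) filter) = (INF e\<in>{0<..}. principal {(x, y). dist x y < e})"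
    by (rule uniformity_ell2_def)
  show "open U \<longleftrightarrow> (\<forall>x\<in>U. eventually (\<lambda>(x', y). x' = x \<longrightarrow> y \<in> U) uniformity)" for U :: "ell2 set"
    by (rule open_ell2_def)
  show "norm x = 0 \<longleftrightarrow> x = 0"
  proof -
    have "norm x = 0 \<longleftrightarrow> (\<forall>i. (cmod (coord x i))\<^sup>2 = 0)"
      unfolding norm_ell2_def using suminf_eq_zero_iff[OF summable_coord, of x] by simp
    then show ?thesis
      by (simp add: coord_inject[symmetric] zero_ell2.rep_eq fun_eq_iff)
  qed
  show "norm (r *\<^sub>R x) = \<bar>r\<bar> * norm x"
    unfolding norm_ell2_def
    by (simp add: scaleR_ell2.rep_eq power_mult_distrib suminf_mult summable_coord real_sqrt_mult)
  show "norm (x + y) \<le> norm x + norm y"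
  proof -
    have lim: "(\<lambda>n. L2_set (\<lambda>i. cmod (coord z i)) {..<n}) \<longlonglongrightarrow> norm z" for z
      unfolding L2_set_def norm_ell2_def
      by (intro tendsto_real_sqrt summable_LIMSEQ summable_coord)
    have "L2_set (\<lambda>i. cmod (coord (x + y) i)) {..<n}
        \<le> L2_set (\<lambda>i. cmod (coord x i)) {..<n} + L2_set (\<lambda>i. cmod (coord y i)) {..<n}" for n
      by (rule order_trans[OF L2_set_mono L2_set_triangle_ineq])
         (simp_all add: plus_ell2.rep_eq norm_triangle_ineq)
    then show ?thesis
      by (intro LIMSEQ_le[OF lim tendsto_add[OF lim lim]]) auto
  qed
qed

end

section \<open>Band operators\<close>

definition entry :: "(ell2 \<Rightarrow> ell2) \<Rightarrow> nat \<Rightarrow> nat \<Rightarrow> complex" where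
  "entry A i j = coord (A (unit_seq j)) i"

definition diagonal_offsets :: "(ell2 \<Rightarrow> ell2) \<Rightarrow> nat set" where
  "diagonal_offsets A = {nat \<bar>int i - int j\<bar> | i j. entry A i j \<noteq> 0}"

text \<open>
  That \<open>A\<close> acts by its matrix, and that every diagonal is bounded, follows from bounded complex
  linearity; see \<open>band_operator_apply\<close> and \<open>cmod_entry_le\<close> below.
\<close>

definition band_operator :: "(ell2 \<Rightarrow> ell2) \<Rightarrow> bool" where
  "band_operator A \<longleftrightarrow>
     bounded_linear A \<and> (\<forall>c x. A (cscale c x) = cscale c (A x)) \<and> finite (diagonal_offsets A)"

text \<open>The zero operator gets bandwidth \<open>Sup {} = 0\<close>.\<close>

definition bandwidth :: "(ell2 \<Rightarrow> ell2) \<Rightarrow> nat" where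
  "bandwidth A = Sup (diagonal_offsets A)"

text \<open>
  The Banach space adjoint: the transposed matrix, without complex conjugation. The sequence to
  which the abstraction function is applied is square-summable when \<open>A\<close> is a band operator; see
  \<open>coord_transpose_op\<close> below.
\<close>

definition transpose_op :: "(ell2 \<Rightarrow> ell2) \<Rightarrow> ell2 \<Rightarrow> ell2" where
  "transpose_op A x = Abs_ell2 (\<lambda>i. \<Sum>j. entry A j i * coord x j)"

lemma cmod_coord_le: "cmod (coord x i) \<le> norm x"
proof -
  have "(\<Sum>k\<in>{i}. (cmod (coord x k))\<^sup>2) \<le> (\<Sum>k. (cmod (coord x k))\<^sup>2)"
    by (intro sum_le_suminf summable_coord) auto
  then show ?thesis
    unfolding norm_ell2_def by (simp add: real_le_rsqrt)
qed

lemma norm_unit_seq: "norm (unit_seq j) = 1"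
proof -
  have "(\<Sum>i. (cmod (coord (unit_seq j) i))\<^sup>2) = (\<Sum>i\<in>{j}. (cmod (coord (unit_seq j) i))\<^sup>2)"
    by (rule suminf_finite) (auto simp: unit_seq.rep_eq)
  then show ?thesis by (simp add: norm_ell2_def unit_seq.rep_eq)
qed

lemma cmod_entry_le:
  assumes "bounded_linear A"
  shows "cmod (entry A i j) \<le> onorm A"
  using order_trans[OF cmod_coord_le onorm[OF assms, of "unit_seq j"]]
  by (simp add: entry_def norm_unit_seq)

lemma entry_eq_0:
  assumes "band_operator A" "bandwidth A < nat \<bar>int i - int j\<bar>"
  shows "entry A i j = 0"
proof (rule ccontr)
  assume "entry A i j \<noteq> 0"
  then have "nat \<bar>int i - int j\<bar> \<in> diagonal_offsets A"
    unfolding diagonal_offsets_def by blast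
  then have "nat \<bar>int i - int j\<bar> \<le> bandwidth A"
    unfolding bandwidth_def using assms(1) by (auto simp: band_operator_def intro: le_cSup_finite)
  with assms(2) show False by simp
qed

lemma coord_sum: "coord (\<Sum>j\<in>J. f j) i = (\<Sum>j\<in>J. coord (f j) i)"
  by (induction J rule: infinite_finite_induct) (simp_all add: zero_ell2.rep_eq plus_ell2.rep_eq)

lemma truncation_tendsto: "(\<lambda>n. \<Sum>j<n. cscale (coord x j) (unit_seq j)) \<longlonglongrightarrow> x"
proof (rule LIM_zero_cancel, rule tendsto_norm_zero_cancel)
  let ?f = "\<lambda>i. (cmod (coord x i))\<^sup>2"
  have "norm ((\<Sum>j<n. cscale (coord x j) (unit_seq j)) - x) = sqrt (suminf ?f - sum ?f {..<n})" for n
  proof -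
    have c: "coord ((\<Sum>j<n. cscale (coord x j) (unit_seq j)) - x) i
        = (if i < n then 0 else - coord x i)" for i
      by (simp add: minus_ell2.rep_eq coord_sum cscale.rep_eq unit_seq.rep_eq if_distrib
          cong: if_cong)
    have "(\<Sum>i. (cmod (if i < n then 0 else - coord x i))\<^sup>2) = (\<Sum>i. if i < n then 0 else ?f i)"
      by (intro arg_cong[of _ _ suminf]) auto
    also have "\<dots> = (\<Sum>i. ?f i - (if i \<in> {..<n} then ?f i else 0))"
      by (intro arg_cong[of _ _ suminf]) auto
    also have "\<dots> = suminf ?f - sum ?f {..<n}"
      using sums_If_finite_set[of "{..<n}" ?f]
      by (subst suminf_diff[symmetric]) (auto simp: summable_coord sums_iff)
    finally show ?thesis by (simp add: norm_ell2_def c)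
  qed
  moreover have "(\<lambda>n. sqrt (suminf ?f - sum ?f {..<n})) \<longlonglongrightarrow> sqrt (suminf ?f - suminf ?f)"
    by (intro tendsto_intros summable_LIMSEQ summable_coord)
  ultimately show "(\<lambda>n. norm ((\<Sum>j<n. cscale (coord x j) (unit_seq j)) - x)) \<longlonglongrightarrow> 0"
    by simp
qed

lemma bounded_linear_coord: "bounded_linear (\<lambda>x. coord x i)"
  by (rule bounded_linear_intro[where K = 1])
     (simp_all add: plus_ell2.rep_eq scaleR_ell2.rep_eq cmod_coord_le)

lemma band_operator_apply:
  assumes "band_operator A"
  shows "(\<lambda>j. entry A i j * coord x j) sums coord (A x) i"
proof -
  have bl: "bounded_linear A" and cl: "\<And>c x. A (cscale c x) = cscale c (A x)"
    using assms by (auto simp: band_operator_def)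
  have "(\<lambda>n. coord (A (\<Sum>j<n. cscale (coord x j) (unit_seq j))) i) \<longlonglongrightarrow> coord (A x) i"
    by (intro bounded_linear.tendsto[OF bounded_linear_coord] bounded_linear.tendsto[OF bl]
        truncation_tendsto)
  moreover have "coord (A (\<Sum>j<n. cscale (coord x j) (unit_seq j))) i
      = (\<Sum>j<n. entry A i j * coord x j)" for n
    by (simp add: linear_sum[OF bounded_linear.linear[OF bl]] cl coord_sum cscale.rep_eq
        entry_def mult.commute)
  ultimately show ?thesis by (simp add: sums_def)
qed

lemma coord_transpose_op:
  assumes "band_operator A"
  shows "coord (transpose_op A x) i = (\<Sum>j. entry A j i * coord x j)"
proof -
  define b where "b = bandwidth A"
  define C where "C = onorm A"
  define S where "S i = {j. nat \<bar>int i - int j\<bar> \<le> b}" for i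
  have C: "cmod (entry A i j) \<le> C" for i j
    using assms cmod_entry_le by (auto simp: band_operator_def C_def)
  have S_sub: "S i \<subseteq> (\<lambda>s. i + s) ` {..b} \<union> (\<lambda>s. i - s) ` {..b}" for i
  proof
    fix j assume "j \<in> S i"
    then have "j = i + (j - i) \<and> j - i \<le> b \<or> j = i - (i - j) \<and> i - j \<le> b"
      by (auto simp: S_def)
    then show "j \<in> (\<lambda>s. i + s) ` {..b} \<union> (\<lambda>s. i - s) ` {..b}" by blast
  qed
  have fin: "finite (S i)" for i
    by (rule finite_subset[OF S_sub]) auto
  have "card (S i) \<le> card ({i - b..i + b})" for i
    by (rule card_mono) (auto simp: S_def)
  then have card: "card (S i) \<le> 2 * b + 1" for i
    by (rule order_trans) auto
  let ?f = "\<lambda>j. (cmod (coord x j))\<^sup>2"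
  have row: "(\<Sum>j. entry A j i * coord x j) = (\<Sum>j\<in>S i. entry A j i * coord x j)" for i
    by (rule suminf_finite[OF fin]) (auto simp: S_def b_def entry_eq_0[OF assms] abs_minus_commute)
  have "summable (\<lambda>i. (cmod (\<Sum>j. entry A j i * coord x j))\<^sup>2)"
  proof (rule summable_comparison_test')
    have "summable (\<lambda>i. ?f (i - s))" for s
      by (subst summable_iff_shift[symmetric, of _ s]) (simp add: summable_coord)
    moreover have "summable (\<lambda>i. ?f (i + s))" for s
      by (subst summable_iff_shift) (rule summable_coord)
    ultimately show "summable (\<lambda>i. real (2 * b + 1) * (C\<^sup>2 * (\<Sum>s\<le>b. ?f (i + s) + ?f (i - s))))"
      by (intro summable_mult summable_sum summable_add)
    fix i :: nat
    have "(cmod (\<Sum>j\<in>S i. entry A j i * coord x j))\<^sup>2 \<le> (\<Sum>j\<in>S i. C * cmod (coord x j))\<^sup>2"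
      by (intro power_mono norm_ge_zero sum_norm_le) (simp add: norm_mult C mult_right_mono)
    also have "\<dots> \<le> (\<Sum>j\<in>S i. (C * cmod (coord x j))\<^sup>2) * real (card (S i))"
      by (rule sum_squared_le_sum_of_squares)
    also have "\<dots> \<le> (\<Sum>j\<in>S i. (C * cmod (coord x j))\<^sup>2) * real (2 * b + 1)"
      by (intro mult_left_mono of_nat_mono card sum_nonneg) auto
    also have "(\<Sum>j\<in>S i. (C * cmod (coord x j))\<^sup>2) = C\<^sup>2 * sum ?f (S i)"
      by (simp add: power_mult_distrib sum_distrib_left)
    also have "sum ?f (S i) \<le> sum ?f ((\<lambda>s. i + s) ` {..b} \<union> (\<lambda>s. i - s) ` {..b})"
      by (intro sum_mono2 S_sub) auto
    also have "\<dots> \<le> sum ?f ((\<lambda>s. i + s) ` {..b}) + sum ?f ((\<lambda>s. i - s) ` {..b})"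
      by (subst sum.union_inter[symmetric]) (auto intro!: sum_nonneg)
    also have "\<dots> \<le> (\<Sum>s\<le>b. ?f (i + s)) + (\<Sum>s\<le>b. ?f (i - s))"
      by (intro add_mono order_trans[OF sum_image_le]) auto
    finally show "norm ((cmod (\<Sum>j. entry A j i * coord x j))\<^sup>2)
        \<le> real (2 * b + 1) * (C\<^sup>2 * (\<Sum>s\<le>b. ?f (i + s) + ?f (i - s)))"
      unfolding row by (simp add: sum.distrib mult.commute mult_left_mono mult_right_mono)
  qed
  then show ?thesis
    by (simp add: transpose_op_def Abs_ell2_inverse)
qed

section \<open>Block-tridiagonal representation\<close>

text \<open>
  The identification of the scalar sequence space with the \<open>\<complex>\<^sup>d\<close>-valued one is kept implicit: block
  \<open>k\<close> consists of the scalar indices \<open>m\<close> with \<open>m div d = k\<close>, and a \<open>d \<times> d\<close> matrix is a function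
  on pairs of indices below \<open>d\<close>.
\<close>

definition block_size :: "(ell2 \<Rightarrow> ell2) \<Rightarrow> nat" where
  "block_size A = (if bandwidth A \<le> 1 then 1 else bandwidth A + 1)"

definition block :: "(ell2 \<Rightarrow> ell2) \<Rightarrow> nat \<Rightarrow> nat \<Rightarrow> nat \<Rightarrow> nat \<Rightarrow> complex" where
  "block A i j = (\<lambda>r c. entry A (i * block_size A + r) (j * block_size A + c))"

definition matrix_norm :: "nat \<Rightarrow> (nat \<Rightarrow> nat \<Rightarrow> complex) \<Rightarrow> real" where
  "matrix_norm d M =
     Sup {L2_set (\<lambda>r. cmod (\<Sum>c<d. M r c * v c)) {..<d} | v. L2_set (\<lambda>c. cmod (v c)) {..<d} = 1}"

definition subdiag_norm :: "(ell2 \<Rightarrow> ell2) \<Rightarrow> real" where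
  "subdiag_norm A = (SUP i. matrix_norm (block_size A) (block A (Suc i) i))"

definition superdiag_norm :: "(ell2 \<Rightarrow> ell2) \<Rightarrow> real" where
  "superdiag_norm A = (SUP i. matrix_norm (block_size A) (block A i (Suc i)))"

definition eps_n :: "(ell2 \<Rightarrow> ell2) \<Rightarrow> nat \<Rightarrow> real" where
  "eps_n A n = 2 * (subdiag_norm A + superdiag_norm A) * sin (pi / (2 * (real n + 1)))"

section \<open>Pseudospectra\<close>

definition shift_op :: "(ell2 \<Rightarrow> ell2) \<Rightarrow> complex \<Rightarrow> ell2 \<Rightarrow> ell2" where
  "shift_op B z = (\<lambda>x. B x - cscale z x)"

definition inverse_norm :: "(ell2 \<Rightarrow> ell2) \<Rightarrow> ereal" where
  "inverse_norm B = (if bij B \<and> bounded_linear (inv B) then ereal (onorm (inv B)) else \<infinity>)"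

definition pseudospectrum :: "real \<Rightarrow> (ell2 \<Rightarrow> ell2) \<Rightarrow> complex set" where
  "pseudospectrum \<epsilon> A = {z. inverse_norm (shift_op A z) > ereal (1 / \<epsilon>)}"

definition lower_norm_on :: "ell2 set \<Rightarrow> (ell2 \<Rightarrow> ell2) \<Rightarrow> real" where
  "lower_norm_on V B = (INF x\<in>{x \<in> V. norm x = 1}. norm (B x))"

definition block_window :: "nat \<Rightarrow> nat \<Rightarrow> nat \<Rightarrow> ell2 set" where
  "block_window d n k = {x. \<forall>m. coord x m \<noteq> 0 \<longrightarrow> m div d \<in> {k..<k + n}}"

definition pseudospectrum_cols ::
    "nat \<Rightarrow> real \<Rightarrow> (ell2 \<Rightarrow> ell2) \<Rightarrow> nat \<Rightarrow> nat \<Rightarrow> complex set" where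
  "pseudospectrum_cols d \<epsilon> B n k = {z. lower_norm_on (block_window d n k) (shift_op B z) < \<epsilon>}"

definition pseudospectrum_pair ::
    "real \<Rightarrow> (ell2 \<Rightarrow> ell2) \<Rightarrow> nat \<Rightarrow> nat \<Rightarrow> complex set" where
  "pseudospectrum_pair \<epsilon> A n k =
     pseudospectrum_cols (block_size A) \<epsilon> A n k \<union>
     pseudospectrum_cols (block_size A) \<epsilon> (transpose_op A) n k"

section \<open>Hausdorff convergence\<close>

definition hausdorff_dist :: "complex set \<Rightarrow> complex set \<Rightarrow> real" where
  "hausdorff_dist S T = max (SUP s\<in>S. infdist s T) (SUP t\<in>T. infdist t S)"

text \<open>
  The distance is meaningful for nonempty bounded sets only (\<open>infdist\<close> to the empty set is \<open>0\<close>,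
  and a real supremum over an unbounded set is unspecified), so this is part of convergence.
\<close>

definition hausdorff_converges :: "(nat \<Rightarrow> complex set) \<Rightarrow> complex set \<Rightarrow> bool" where
  "hausdorff_converges S T \<longleftrightarrow>
     T \<noteq> {} \<and> bounded T \<and> (\<forall>\<^sub>F n in sequentially. S n \<noteq> {} \<and> bounded (S n)) \<and>
     (\<lambda>n. hausdorff_dist (S n) T) \<longlonglongrightarrow> 0"

end

theory Submission
  imports Defs
begin

text \<open>
  Let \<open>\<mu>(z)\<close> be the smaller of the lower norms of \<open>A - z\<close> and of its transpose. Then \<open>\<mu>(z)\<close>
  is the reciprocal of the resolvent norm (lemma \<open>inverse_norm_greater_iff\<close>), so the pseudospectrum is
  the sublevel set \<open>{\<mu> < \<epsilon>}\<close>. The left inclusion holds because restricting an operator to a window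
  cannot decrease its lower norm.

  The right inclusion is a localisation estimate (\<open>window_localisation\<close>). An approximate eigenvector \<open>x\<close>
  is cut into overlapping windows of \<open>n\<close> blocks by weights that vanish at both ends. A block tridiagonal
  operator nearly commutes with such weights: the error involves only its two off-diagonals and the
  differences of neighbouring weights. Averaged over all positions of the window, the relative error is
  \<open>\<parallel>\<alpha>\<parallel> + \<parallel>\<gamma>\<parallel>\<close> times the square root of the Rayleigh quotient of the weights for the discrete
  Laplacian; sine weights minimise it and give \<open>\<epsilon>\<^sub>n\<close>. Hence some window carries a vector that is at
  least as good as the average. The same applies to the transpose, whose off-diagonals are those of
  \<open>A\<close> exchanged and transposed.

  For the convergence, \<open>\<epsilon>\<^sub>n \<longlonglongrightarrow> 0\<close> and the two inclusions show that the subsets exhaust \<open>{\<mu> < \<epsilon>}\<close>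
  pointwise and that the supersets lie in \<open>{\<mu> < \<epsilon> + \<epsilon>\<^sub>n}\<close>. Compactness turns both into Hausdorff
  convergence, provided that the closure of \<open>{\<mu> < \<epsilon>}\<close> contains the level set \<open>{\<mu> = \<epsilon>}\<close>. This holds
  because \<open>\<mu>\<close> has no positive local minimum (\<open>shifted_lower_norm_decreases\<close>), a property of Hilbert
  spaces that can fail in Banach spaces. It also shows that the pseudospectrum is nonempty:
  \<open>\<mu>\<close> is continuous and tends to infinity, so it attains its minimum, which can only be \<open>0\<close>.
\<close>

section \<open>The sequence space as a Hilbert space\<close>

lift_definition cnj_seq :: "ell2 \<Rightarrow> ell2" is "\<lambda>x i. cnj (x i)" by simp

lemma ell2_eq_iff: "x = y \<longleftrightarrow> (\<forall>i. coord x i = coord y i)"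
  by (simp add: coord_inject[symmetric] fun_eq_iff)

lemmas ell2_coords = zero_ell2.rep_eq plus_ell2.rep_eq uminus_ell2.rep_eq minus_ell2.rep_eq
  scaleR_ell2.rep_eq cscale.rep_eq unit_seq.rep_eq cnj_seq.rep_eq

lemma summable_coord_mult: "summable (\<lambda>i. coord x i * coord y i)"
proof (rule summable_comparison_test')
  show "summable (\<lambda>i. (cmod (coord x i))\<^sup>2 + (cmod (coord y i))\<^sup>2)"
    by (intro summable_add summable_coord)
  fix i :: nat
  show "norm (coord x i * coord y i) \<le> (cmod (coord x i))\<^sup>2 + (cmod (coord y i))\<^sup>2"
    using sum_squares_bound[of "cmod (coord x i)" "cmod (coord y i)"]
      mult_nonneg_nonneg[OF norm_ge_zero norm_ge_zero, of "coord x i" "coord y i"]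
    unfolding norm_mult by linarith
qed

lemma summable_coord_mult_cnj: "summable (\<lambda>i. coord x i * cnj (coord y i))"
  using summable_coord_mult[of x "cnj_seq y"] by (simp add: cnj_seq.rep_eq)

lemmas summable_inner_terms = summable_Re[OF summable_coord_mult_cnj]

instantiation ell2 :: real_inner
begin

definition inner_ell2 :: "ell2 \<Rightarrow> ell2 \<Rightarrow> real" where
  "inner_ell2 x y = (\<Sum>i. Re (coord x i * cnj (coord y i)))"

instance
proof
  fix x y z :: ell2 and r :: real
  show "inner x y = inner y x"
    unfolding inner_ell2_def by (intro arg_cong[of _ _ suminf]) (auto simp: algebra_simps)
  show "inner (x + y) z = inner x z + inner y z"
    unfolding inner_ell2_def
    by (subst suminf_add[OF summable_inner_terms summable_inner_terms])
       (simp add: plus_ell2.rep_eq algebra_simps)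
  show "inner (r *\<^sub>R x) y = r * inner x y"
    unfolding inner_ell2_def
    by (subst suminf_mult[OF summable_inner_terms, symmetric])
       (simp add: scaleR_ell2.rep_eq algebra_simps)
  have sq: "inner x x = (\<Sum>i. (cmod (coord x i))\<^sup>2)"
    unfolding inner_ell2_def cmod_power2 by (simp add: power2_eq_square)
  show nonneg: "0 \<le> inner x x"
    unfolding sq by (intro suminf_nonneg summable_coord) auto
  show norm: "norm x = sqrt (inner x x)"
    unfolding sq norm_ell2_def ..
  show "inner x x = 0 \<longleftrightarrow> x = 0"
    using nonneg by (metis norm norm_eq_zero real_sqrt_eq_zero_cancel_iff)
qed

end

lemma inner_ell2_Re: "inner x y = Re (\<Sum>i. coord x i * cnj (coord y i))"
  unfolding inner_ell2_def
  by (rule bounded_linear.suminf[OF bounded_linear_Re summable_coord_mult_cnj, symmetric])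

lemma norm_add_power2: "(norm (a + b))\<^sup>2 = (norm a)\<^sup>2 + 2 * inner a b + (norm b)\<^sup>2"
  for a b :: "'a::real_inner"
  unfolding power2_norm_eq_inner by (simp only: inner_add_left inner_add_right inner_commute[of b a])

lemma norm_diff_power2: "(norm (a - b))\<^sup>2 = (norm a)\<^sup>2 - 2 * inner a b + (norm b)\<^sup>2"
  for a b :: "'a::real_inner"
  using norm_add_power2[of a "- b"] by simp

lemma norm_ell2_power2: "(norm x)\<^sup>2 = (\<Sum>i. (cmod (coord x i))\<^sup>2)" for x :: ell2
  unfolding norm_ell2_def by (intro real_sqrt_pow2 suminf_nonneg summable_coord) auto

lemma sum_coord_le_norm: "(\<Sum>i<n. (cmod (coord x i))\<^sup>2) \<le> (norm x)\<^sup>2"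
  unfolding norm_ell2_power2 by (intro sum_le_suminf summable_coord) auto

text \<open>
  Recognises a coordinatewise limit as a member of the space, with a norm bound, from bounds on
  its finite sections.
\<close>

lemma coordwise_bound_ell2:
  fixes f :: "nat \<Rightarrow> complex"
  assumes "\<And>n. (\<Sum>i<n. (cmod (f i))\<^sup>2) \<le> c\<^sup>2" and "0 \<le> c"
  obtains x where "coord x = f" "norm x \<le> c"
proof
  have sum: "summable (\<lambda>i. (cmod (f i))\<^sup>2)"
    using assms(1) by (intro summableI_nonneg_bounded[where x = "c\<^sup>2"]) auto
  then show co: "coord (Abs_ell2 f) = f"
    by (simp add: Abs_ell2_inverse)
  have "(norm (Abs_ell2 f))\<^sup>2 \<le> c\<^sup>2"
    unfolding norm_ell2_power2 co using sum assms(1) by (rule suminf_le_const)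
  then show "norm (Abs_ell2 f) \<le> c"
    using assms(2) by (rule power2_le_imp_le)
qed

text \<open>
  Completeness enters once, for the fixed point argument that makes an operator surjective. The
  candidate limit is taken coordinatewise; Cauchy estimates pass to it on every finite section.
\<close>

instance ell2 :: complete_space
proof
  fix X :: "nat \<Rightarrow> ell2"
  assume "Cauchy X"
  then have "Cauchy (\<lambda>n. coord (X n) i)" for i
    by (rule bounded_linear.Cauchy[OF bounded_linear_coord])
  then obtain f where f: "(\<lambda>n. coord (X n) i) \<longlonglongrightarrow> f i" for i
    unfolding Cauchy_convergent_iff convergent_def by metis
  have close: "\<exists>N. \<forall>n\<ge>N. \<exists>y. coord y = (\<lambda>i. f i - coord (X n) i) \<and> norm y \<le> e" if "e > 0" for e
  proof -
    obtain N where N: "norm (X m - X n) < e" if "m \<ge> N" "n \<ge> N" for m n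
      using \<open>Cauchy X\<close> \<open>e > 0\<close> unfolding Cauchy_iff by blast
    have "\<exists>y. coord y = (\<lambda>i. f i - coord (X n) i) \<and> norm y \<le> e" if "n \<ge> N" for n
    proof -
      have "(\<Sum>i<k. (cmod (f i - coord (X n) i))\<^sup>2) \<le> e\<^sup>2" for k
      proof (rule LIMSEQ_le_const2)
        show "(\<lambda>m. \<Sum>i<k. (cmod (coord (X m) i - coord (X n) i))\<^sup>2)
            \<longlonglongrightarrow> (\<Sum>i<k. (cmod (f i - coord (X n) i))\<^sup>2)"
          by (intro tendsto_intros f)
        have "(\<Sum>i<k. (cmod (coord (X m) i - coord (X n) i))\<^sup>2) \<le> e\<^sup>2" if "m \<ge> N" for m
          using order_trans[OF sum_coord_le_norm[of "X m - X n" k]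
              power_mono[OF less_imp_le[OF N[OF that \<open>n \<ge> N\<close>]]]]
          by (simp add: minus_ell2.rep_eq)
        then show "\<exists>N. \<forall>m\<ge>N. (\<Sum>i<k. (cmod (coord (X m) i - coord (X n) i))\<^sup>2) \<le> e\<^sup>2"
          by blast
      qed
      with \<open>e > 0\<close> show ?thesis
        by (metis coordwise_bound_ell2 less_imp_le)
    qed
    then show ?thesis by blast
  qed
  obtain N y where y: "coord y = (\<lambda>i. f i - coord (X N) i)"
    using close[of 1] by auto
  define L where "L = y + X N"
  have L: "coord L = f"
    by (simp add: L_def plus_ell2.rep_eq y)
  have "X \<longlonglongrightarrow> L"
  proof (rule LIMSEQ_I)
    fix e :: real assume "e > 0"
    then obtain N where N: "\<And>n. n \<ge> N \<Longrightarrow>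
        \<exists>y. coord y = (\<lambda>i. f i - coord (X n) i) \<and> norm y \<le> e / 2"
      using close[of "e / 2"] by auto
    have "norm (X n - L) < e" if n: "n \<ge> N" for n
    proof -
      obtain y where y: "coord y = (\<lambda>i. f i - coord (X n) i)" "norm y \<le> e / 2"
        using N[OF n] by blast
      have "y = L - X n"
        by (simp add: coord_inject[symmetric] y L minus_ell2.rep_eq fun_eq_iff)
      with y(2) \<open>e > 0\<close> show ?thesis by (simp add: norm_minus_commute)
    qed
    then show "\<exists>N. \<forall>n\<ge>N. norm (X n - L) < e" by blast
  qed
  then show "convergent X" by (rule convergentI)
qed

lemma cnj_seq_cnj_seq [simp]: "cnj_seq (cnj_seq x) = x"
  by (simp add: ell2_eq_iff ell2_coords)

lemma cnj_seq_algebra: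
  "cnj_seq (x + y) = cnj_seq x + cnj_seq y"
  "cnj_seq (x - y) = cnj_seq x - cnj_seq y"
  "cnj_seq (r *\<^sub>R x) = r *\<^sub>R cnj_seq x"
  "cnj_seq (cscale c x) = cscale (cnj c) (cnj_seq x)"
  by (simp_all add: ell2_eq_iff ell2_coords)

lemma inner_cnj_seq: "inner (cnj_seq x) (cnj_seq y) = inner x y"
  by (simp add: inner_ell2_def cnj_seq.rep_eq)

lemma norm_cnj_seq [simp]: "norm (cnj_seq x) = norm x"
  by (simp add: norm_ell2_def cnj_seq.rep_eq)

lemma bounded_linear_cnj_seq: "bounded_linear cnj_seq"
  by (rule bounded_linear_intro[where K = 1]) (simp_all add: cnj_seq_algebra)

lemma norm_cscale: "norm (cscale c x) = cmod c * norm x"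
  by (simp add: norm_ell2_def cscale.rep_eq norm_mult power_mult_distrib
      suminf_mult summable_coord real_sqrt_mult)

lemma cscale_algebra:
  "cscale c (x + y) = cscale c x + cscale c y"
  "cscale c (x - y) = cscale c x - cscale c y"
  "cscale (c + e) x = cscale c x + cscale e x"
  "cscale c (cscale e x) = cscale (c * e) x"
  "cscale (- c) x = - cscale c x"
  "cscale c (r *\<^sub>R x) = r *\<^sub>R cscale c x"
  "cscale (complex_of_real r) x = r *\<^sub>R x"
  by (simp_all add: ell2_eq_iff ell2_coords algebra_simps scaleR_conv_of_real)

lemma bounded_linear_cscale: "bounded_linear (cscale c)"
  by (rule bounded_linear_intro[where K = "cmod c"])
     (simp_all add: cscale_algebra norm_cscale)

lemma inner_cscale: "inner (cscale c x) y = inner x (cscale (cnj c) y)"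
  by (simp add: inner_ell2_def cscale.rep_eq algebra_simps)

section \<open>Lower norms and invertibility\<close>

text \<open>
  This is the Hilbert space adjointness of \<open>B\<close> and the conjugate of \<open>C\<close>. It is stated with two
  conjugations rather than with the bilinear pairing so that the real inner product can be used; as
  conjugation is an isometry, \<open>C\<close> has the same lower norm as the Hilbert space adjoint of \<open>B\<close>.
\<close>

definition transposed_pair :: "(ell2 \<Rightarrow> ell2) \<Rightarrow> (ell2 \<Rightarrow> ell2) \<Rightarrow> bool" where
  "transposed_pair B C \<longleftrightarrow> bounded_linear B \<and> bounded_linear C \<and>
     (\<forall>x y. inner (B x) y = inner x (cnj_seq (C (cnj_seq y))))"

lemma transposed_pairD:
  assumes "transposed_pair B C"
  shows "bounded_linear B" "bounded_linear C"
    "inner (B x) y = inner x (cnj_seq (C (cnj_seq y)))"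
  using assms by (auto simp: transposed_pair_def)

lemma transposed_pair_commute:
  assumes "transposed_pair B C"
  shows "transposed_pair C B"
proof -
  have "inner (C x) y = inner x (cnj_seq (B (cnj_seq y)))" for x y
  proof -
    have "inner (C x) y = inner (cnj_seq (C x)) (cnj_seq y)"
      by (simp add: inner_cnj_seq)
    also have "\<dots> = inner (B (cnj_seq y)) (cnj_seq x)"
      using transposed_pairD(3)[OF assms, of "cnj_seq y" "cnj_seq x"] by (simp add: inner_commute)
    also have "\<dots> = inner x (cnj_seq (B (cnj_seq y)))"
      using inner_cnj_seq[of "B (cnj_seq y)" "cnj_seq x"]
        inner_cnj_seq[of "cnj_seq (B (cnj_seq y))" x] by (simp add: inner_commute)
    finally show ?thesis .
  qed
  then show ?thesis
    using transposed_pairD(1,2)[OF assms] by (simp add: transposed_pair_def)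
qed

lemma bounded_linear_shift_op: "bounded_linear B \<Longrightarrow> bounded_linear (shift_op B z)"
  unfolding shift_op_def by (intro bounded_linear_sub bounded_linear_cscale)

lemma transposed_pair_shift_op:
  assumes "transposed_pair B C"
  shows "transposed_pair (shift_op B z) (shift_op C z)"
proof -
  have "inner (shift_op B z x) y = inner x (cnj_seq (shift_op C z (cnj_seq y)))" for x y
    by (simp add: shift_op_def inner_diff_left inner_diff_right cnj_seq_algebra inner_cscale
        transposed_pairD(3)[OF assms])
  then show ?thesis
    using transposed_pairD(1,2)[OF assms] by (simp add: transposed_pair_def bounded_linear_shift_op)
qed

text \<open>
  The homogeneous form avoids normalising vectors: a strict inequality on the right already
  excludes \<open>x = 0\<close>.
\<close>

lemma lower_norm_on_less_iff:
  assumes B: "bounded_linear B" and V: "\<And>x r. x \<in> V \<Longrightarrow> r *\<^sub>R x \<in> V" and "e \<in> V" "e \<noteq> 0"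
  shows "lower_norm_on V B < \<epsilon> \<longleftrightarrow> (\<exists>x\<in>V. norm (B x) < \<epsilon> * norm x)"
proof -
  have ne: "{x \<in> V. norm x = 1} \<noteq> {}"
    using V[OF \<open>e \<in> V\<close>, of "inverse (norm e)"] \<open>e \<noteq> 0\<close>
    by (auto intro!: exI[of _ "inverse (norm e) *\<^sub>R e"])
  have "bdd_below ((\<lambda>x. norm (B x)) ` {x \<in> V. norm x = 1})"
    by (rule bdd_belowI[of _ 0]) auto
  then have "lower_norm_on V B < \<epsilon> \<longleftrightarrow> (\<exists>x\<in>V. norm x = 1 \<and> norm (B x) < \<epsilon>)"
    unfolding lower_norm_on_def using ne by (subst cInf_less_iff) auto
  also have "\<dots> \<longleftrightarrow> (\<exists>x\<in>V. norm (B x) < \<epsilon> * norm x)"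
  proof
    assume "\<exists>x\<in>V. norm (B x) < \<epsilon> * norm x"
    then obtain x where x: "x \<in> V" "norm (B x) < \<epsilon> * norm x" by blast
    have "x \<noteq> 0"
      using x(2) linear_0[OF bounded_linear.linear[OF B]] by auto
    then have "norm (B (inverse (norm x) *\<^sub>R x)) < \<epsilon>"
      using x(2) by (simp add: linear_scale[OF bounded_linear.linear[OF B]] field_simps)
    moreover have "norm (inverse (norm x) *\<^sub>R x) = 1"
      using \<open>x \<noteq> 0\<close> by simp
    ultimately show "\<exists>x\<in>V. norm x = 1 \<and> norm (B x) < \<epsilon>"
      using V[OF x(1)] by blast
  qed force
  finally show ?thesis .
qed

lemma lower_norm_less_iff:
  assumes "bounded_linear B"
  shows "lower_norm_on UNIV B < c \<longleftrightarrow> (\<exists>x. norm (B x) < c * norm x)"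
proof -
  have "unit_seq 0 \<noteq> 0"
    using norm_unit_seq[of 0] by force
  then show ?thesis
    using lower_norm_on_less_iff[OF assms, of UNIV "unit_seq 0"] by simp
qed

text \<open>
  Write \<open>H\<close> for the Hilbert space adjoint of \<open>B\<close>. Then \<open>\<langle>B H y, y\<rangle> = \<parallel>H y\<parallel>\<^sup>2 \<ge> \<epsilon>\<^sup>2 \<parallel>y\<parallel>\<^sup>2\<close>, so for a
  suitable \<open>t > 0\<close> the map \<open>y \<mapsto> y - t B H y\<close> is a strict contraction and Banach's fixed point
  theorem solves \<open>B H x = y\<close>.
\<close>

lemma surj_if_transpose_bounded_below:
  assumes pair: "transposed_pair B C" and "0 < \<epsilon>" and C: "\<And>y. \<epsilon> * norm y \<le> norm (C y)"
  shows "surj B"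
proof -
  define H where "H y = cnj_seq (C (cnj_seq y))" for y
  have H: "bounded_linear H" and lowH: "\<epsilon> * norm y \<le> norm (H y)" for y
    unfolding H_def using C[of "cnj_seq y"]
    by (auto intro!: bounded_linear_compose[OF bounded_linear_cnj_seq]
        bounded_linear_compose[OF transposed_pairD(2)[OF pair]] bounded_linear_cnj_seq)
  have BH: "bounded_linear (\<lambda>y. B (H y))"
    by (rule bounded_linear_compose[OF transposed_pairD(1)[OF pair] H])
  obtain K0 where K0: "\<And>y. norm (B (H y)) \<le> norm y * K0"
    using bounded_linear.bounded[OF BH] by blast
  define K where "K = max K0 (\<epsilon>\<^sup>2)"
  have K: "norm (B (H y)) \<le> K * norm y" for y
    using K0[of y] mult_left_mono[of K0 K "norm y"] by (simp add: K_def mult.commute)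
  have "0 < K" "\<epsilon>\<^sup>2 \<le> K"
    using \<open>0 < \<epsilon>\<close> by (simp_all add: K_def less_max_iff_disj)
  \<comment> \<open>\<open>t\<close> minimises the bound \<open>1 - 2 t \<epsilon>\<^sup>2 + t\<^sup>2 K\<^sup>2\<close> for the squared contraction factor, and \<open>q\<close> is its
     minimum; \<open>\<epsilon>\<^sup>2 \<le> K\<close> keeps \<open>q\<close> nonnegative.\<close>
  define t where "t = \<epsilon>\<^sup>2 / K\<^sup>2"
  define q where "q = 1 - (\<epsilon>\<^sup>2 / K)\<^sup>2"
  have "0 \<le> t" by (simp add: t_def)
  have "0 \<le> q" "q < 1"
    using \<open>0 < K\<close> \<open>\<epsilon>\<^sup>2 \<le> K\<close> \<open>0 < \<epsilon>\<close>
    by (simp_all add: q_def power_le_one divide_le_eq)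
  have contract: "norm (y - t *\<^sub>R B (H y)) \<le> sqrt q * norm y" for y
  proof -
    have "inner (B (H y)) y = (norm (H y))\<^sup>2"
      using transposed_pairD(3)[OF pair, of "H y" y] by (simp add: H_def power2_norm_eq_inner inner_cnj_seq)
    then have "(norm (y - t *\<^sub>R B (H y)))\<^sup>2
        = (norm y)\<^sup>2 - 2 * t * (norm (H y))\<^sup>2 + t\<^sup>2 * (norm (B (H y)))\<^sup>2"
      by (simp add: norm_diff_power2 inner_commute power_mult_distrib)
    also have "\<dots> \<le> (norm y)\<^sup>2 - 2 * t * (\<epsilon> * norm y)\<^sup>2 + t\<^sup>2 * (K * norm y)\<^sup>2"
      using \<open>0 \<le> t\<close> \<open>0 < \<epsilon>\<close> lowH[of y] K[of y]
      by (intro add_mono diff_mono mult_left_mono power_mono order_refl) auto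
    also have "\<dots> = q * (norm y)\<^sup>2"
    proof -
      have "t * K\<^sup>2 = \<epsilon>\<^sup>2" and q: "q = 1 - t * \<epsilon>\<^sup>2"
        using \<open>0 < K\<close> by (simp_all add: t_def q_def power_divide power2_eq_square)
      then have "t\<^sup>2 * (K * norm y)\<^sup>2 = t * \<epsilon>\<^sup>2 * (norm y)\<^sup>2"
        by (metis mult.assoc power2_eq_square power_mult_distrib)
      then show ?thesis
        by (simp add: q power_mult_distrib left_diff_distrib)
    qed
    also have "\<dots> = (sqrt q * norm y)\<^sup>2"
      using \<open>0 \<le> q\<close> by (simp add: power_mult_distrib)
    finally show ?thesis
      by (rule power2_le_imp_le) (simp add: \<open>0 \<le> q\<close>)
  qed
  have "\<exists>x. B x = y" for y
  proof -
    define F where "F x = x - t *\<^sub>R B (H x) + t *\<^sub>R y" for x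
    have "dist (F u) (F v) \<le> sqrt q * dist u v" for u v
    proof -
      have "F u - F v = (u - v) - t *\<^sub>R B (H (u - v))"
        by (simp add: F_def linear_diff[OF bounded_linear.linear[OF BH]] algebra_simps)
      then show ?thesis
        using contract[of "u - v"] by (simp add: dist_norm)
    qed
    then have "\<exists>!x. F x = x"
      using \<open>0 \<le> q\<close> \<open>q < 1\<close> by (intro banach_fix_type[of "sqrt q"]) auto
    then obtain x where "F x = x" by blast
    then have "t *\<^sub>R B (H x) = t *\<^sub>R y"
      by (auto simp: F_def algebra_simps)
    moreover have "t \<noteq> 0"
      using \<open>0 < K\<close> \<open>0 < \<epsilon>\<close> by (simp add: t_def)
    ultimately show ?thesis by auto
  qed
  then show ?thesis by (metis surjI)
qed

text \<open>
  If neither lower norm is below \<open>\<epsilon>\<close>, then \<open>B\<close> is injective because of its own bound and surjective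
  because of that of \<open>C\<close>. Conversely, testing \<open>\<parallel>y\<parallel>\<^sup>2\<close> against a preimage of the conjugate of \<open>y\<close>
  transfers a bound on the inverse of \<open>B\<close> into a lower bound for \<open>C\<close>.
\<close>

lemma inverse_norm_greater_iff:
  assumes pair: "transposed_pair B C" and "0 < \<epsilon>"
  shows "ereal (1 / \<epsilon>) < inverse_norm B \<longleftrightarrow>
    (\<exists>x. norm (B x) < \<epsilon> * norm x) \<or> (\<exists>x. norm (C x) < \<epsilon> * norm x)"
proof (rule iffI; rule ccontr)
  assume gr: "ereal (1 / \<epsilon>) < inverse_norm B"
    and "\<not> ((\<exists>x. norm (B x) < \<epsilon> * norm x) \<or> (\<exists>x. norm (C x) < \<epsilon> * norm x))"
  then have B: "\<epsilon> * norm x \<le> norm (B x)" and C: "\<epsilon> * norm x \<le> norm (C x)" for x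
    by (auto simp: not_less)
  note lin = bounded_linear.linear[OF transposed_pairD(1)[OF pair]]
  have "inj B"
  proof (rule injI)
    fix x y assume "B x = B y"
    then have "\<epsilon> * norm (x - y) \<le> 0"
      using B[of "x - y"] by (simp add: linear_diff[OF lin])
    then show "x = y"
      using \<open>0 < \<epsilon>\<close> by (simp add: mult_le_0_iff)
  qed
  moreover have "surj B"
    using surj_if_transpose_bounded_below[OF pair \<open>0 < \<epsilon>\<close> C] .
  ultimately have "bij B" by (simp add: bij_def)
  have inv: "B (inv B y) = y" for y
    using \<open>surj B\<close> by (rule surj_f_inv_f)
  have invI: "inv B y = x" if "B x = y" for x y
    using \<open>inj B\<close> that by (auto intro: inv_f_eq)
  have bound: "norm (inv B y) \<le> norm y * (1 / \<epsilon>)" for y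
    using B[of "inv B y"] \<open>0 < \<epsilon>\<close> by (simp add: inv field_simps)
  have bl: "bounded_linear (inv B)"
    by (rule bounded_linear_intro[OF _ _ bound])
       (auto intro!: invI simp: inv linear_add[OF lin] linear_scale[OF lin])
  have "onorm (inv B) \<le> 1 / \<epsilon>"
    using bound \<open>0 < \<epsilon>\<close> by (intro onorm_bound) (auto simp: mult.commute)
  with gr bl \<open>bij B\<close> show False
    by (simp add: inverse_norm_def)
next
  assume ex: "(\<exists>x. norm (B x) < \<epsilon> * norm x) \<or> (\<exists>x. norm (C x) < \<epsilon> * norm x)"
    and "\<not> ereal (1 / \<epsilon>) < inverse_norm B"
  then have "bij B" and bl: "bounded_linear (inv B)" and on: "onorm (inv B) \<le> 1 / \<epsilon>"
    by (auto simp: inverse_norm_def split: if_splits)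
  have inv: "norm (inv B y) \<le> norm y / \<epsilon>" for y
    using onorm[OF bl, of y] mult_right_mono[OF on norm_ge_zero[of y]] by simp
  have "\<epsilon> * norm x \<le> norm (B x)" for x
    using inv[of "B x"] \<open>bij B\<close> \<open>0 < \<epsilon>\<close> by (simp add: bij_is_inj field_simps)
  moreover have "\<epsilon> * norm y \<le> norm (C y)" for y
  proof -
    define x where "x = inv B (cnj_seq y)"
    have "B x = cnj_seq y"
      unfolding x_def using \<open>bij B\<close> by (simp add: bij_is_surj surj_f_inv_f)
    then have "(norm y)\<^sup>2 = inner (B x) (cnj_seq y)"
      by (simp add: inner_cnj_seq power2_norm_eq_inner)
    also have "\<dots> = inner x (cnj_seq (C y))"
      by (simp add: transposed_pairD(3)[OF pair])
    also have "\<dots> \<le> norm x * norm (C y)"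
      using norm_cauchy_schwarz[of x "cnj_seq (C y)"] by simp
    also have "\<dots> \<le> norm y / \<epsilon> * norm (C y)"
      using inv[of "cnj_seq y"] by (intro mult_right_mono) (simp_all add: x_def)
    finally have "norm y * (\<epsilon> * norm y) \<le> norm y * norm (C y)"
      using \<open>0 < \<epsilon>\<close> by (simp add: field_simps power2_eq_square)
    then show ?thesis
      by (cases "y = 0") auto
  qed
  ultimately show False
    using ex by (auto simp: not_less[symmetric])
qed

section \<open>Absence of positive local minima of the lower norm\<close>

lemma shift_op_shift_op: "shift_op (shift_op B z) h = shift_op B (z + h)"
  by (simp add: shift_op_def fun_eq_iff cscale_algebra)

text \<open>
  The parallelogram law, used below to average over the two signs of a square root.
\<close>

lemma norm_add_cscale_sign:
  "(norm (a + cscale h b))\<^sup>2 + (norm (a + cscale (- h) b))\<^sup>2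
    = 2 * (norm a)\<^sup>2 + 2 * (cmod h)\<^sup>2 * (norm b)\<^sup>2"
  by (simp add: cscale_algebra norm_add_power2 norm_diff_power2 norm_cscale power_mult_distrib)

text \<open>
  Suppose that \<open>\<epsilon>\<close> is a lower bound for all shifts by \<open>h\<close> with \<open>\<bar>h\<bar> < r\<close>. Apply it to
  \<open>(B - h) (B + h) v = B\<^sup>2 v - h\<^sup>2 v\<close> and average the squared norms over \<open>h = \<plusminus>s, \<plusminus>\<i>s\<close>. All cross terms
  cancel, leaving \<open>\<parallel>B u\<parallel>\<^sup>2 + s\<^sup>4 \<parallel>v\<parallel>\<^sup>2 \<ge> \<epsilon>\<^sup>2 (\<parallel>u\<parallel>\<^sup>2 + s\<^sup>2 \<parallel>v\<parallel>\<^sup>2)\<close> for \<open>u = B v\<close>. For \<open>s < \<epsilon>\<close> and bounded \<open>B\<close>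
  this is a gain \<open>\<parallel>B u\<parallel>\<^sup>2 \<ge> (\<epsilon>\<^sup>2 + \<kappa>) \<parallel>u\<parallel>\<^sup>2\<close> with fixed \<open>\<kappa> > 0\<close>. Surjectivity makes it valid for all
  \<open>u\<close>, so \<open>\<epsilon>\<close> is not the infimum.

  This is the classical fact that a Hilbert space resolvent norm has no local maximum, with the
  mean value property of the resolvent replaced by an average over four points.
\<close>

lemma shifted_lower_norm_decreases:
  assumes B: "bounded_linear B" and cl: "\<And>c x. B (cscale c x) = cscale c (B x)"
    and "surj B" and "0 < \<epsilon>" and "0 < r"
    and inf: "\<And>\<delta>. 0 < \<delta> \<Longrightarrow> \<exists>u. norm (B u) < (\<epsilon> + \<delta>) * norm u"
  shows "\<exists>h x. cmod h < r \<and> norm (shift_op B h x) < \<epsilon> * norm x"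
proof (rule ccontr)
  assume "\<not> ?thesis"
  then have low: "\<epsilon> * norm x \<le> norm (B x - cscale h x)" if "cmod h < r" for h x
    using that by (force simp: shift_op_def not_less)
  define s where "s = min (r / 2) (\<epsilon> / 2)"
  have s: "0 < s" "s < r" "s < \<epsilon>"
    using \<open>0 < \<epsilon>\<close> \<open>0 < r\<close> by (auto simp: s_def min_def)
  obtain C where C: "0 < C" "\<And>x. norm (B x) \<le> norm x * C"
    using bounded_linear.pos_bounded[OF B] by blast
  define \<kappa> where "\<kappa> = s\<^sup>2 * (\<epsilon>\<^sup>2 - s\<^sup>2) / C\<^sup>2"
  have "0 < \<kappa>"
    unfolding \<kappa>_def using s \<open>0 < C\<close> by (intro divide_pos_pos mult_pos_pos) (auto intro: power_strict_mono)
  have gain: "(\<epsilon>\<^sup>2 + \<kappa>) * (norm u)\<^sup>2 \<le> (norm (B u))\<^sup>2" for u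
  proof -
    obtain v where v: "u = B v"
      using \<open>surj B\<close> by blast
    have step: "\<epsilon>\<^sup>2 * (norm (u + cscale h v))\<^sup>2 \<le> (norm (B u + cscale (- (h\<^sup>2)) v))\<^sup>2"
      if "cmod h = s" for h
    proof -
      have "B (u + cscale h v) - cscale h (u + cscale h v) = B u + cscale (- (h\<^sup>2)) v"
        by (simp add: linear_add[OF bounded_linear.linear[OF B]] cl v cscale_algebra power2_eq_square)
      then have "\<epsilon> * norm (u + cscale h v) \<le> norm (B u + cscale (- (h\<^sup>2)) v)"
        using low[of h "u + cscale h v"] that s by simp
      then have "(\<epsilon> * norm (u + cscale h v))\<^sup>2 \<le> (norm (B u + cscale (- (h\<^sup>2)) v))\<^sup>2"
        using \<open>0 < \<epsilon>\<close> by (intro power_mono) auto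
      then show ?thesis by (simp add: power_mult_distrib)
    qed
    let ?s = "complex_of_real s" and ?i = "\<i> * complex_of_real s"
    have "\<epsilon>\<^sup>2 * (4 * (norm u)\<^sup>2 + 4 * s\<^sup>2 * (norm v)\<^sup>2)
        = \<epsilon>\<^sup>2 * (norm (u + cscale ?s v))\<^sup>2 + \<epsilon>\<^sup>2 * (norm (u + cscale (- ?s) v))\<^sup>2
        + (\<epsilon>\<^sup>2 * (norm (u + cscale ?i v))\<^sup>2 + \<epsilon>\<^sup>2 * (norm (u + cscale (- ?i) v))\<^sup>2)"
      unfolding distrib_left[symmetric] norm_add_cscale_sign
      by (simp add: norm_mult algebra_simps)
    also have "\<dots> \<le> 2 * ((norm (B u + cscale (?s\<^sup>2) v))\<^sup>2 + (norm (B u + cscale (- (?s\<^sup>2)) v))\<^sup>2)"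
      using step[of ?s] step[of "- ?s"] step[of ?i] step[of "- ?i"] s
      by (simp add: norm_mult power_mult_distrib)
    also have "\<dots> = 4 * (norm (B u))\<^sup>2 + 4 * s^4 * (norm v)\<^sup>2"
      unfolding norm_add_cscale_sign by (simp add: norm_power)
    finally have "\<epsilon>\<^sup>2 * (norm u)\<^sup>2 + s\<^sup>2 * (\<epsilon>\<^sup>2 - s\<^sup>2) * (norm v)\<^sup>2 \<le> (norm (B u))\<^sup>2"
      by (simp add: algebra_simps power_numeral_reduce)
    moreover have "\<kappa> * (norm u)\<^sup>2 \<le> s\<^sup>2 * (\<epsilon>\<^sup>2 - s\<^sup>2) * (norm v)\<^sup>2"
    proof -
      have "(norm u)\<^sup>2 \<le> (norm v * C)\<^sup>2"
        unfolding v by (intro power_mono C) auto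
      then have "\<kappa> * (norm u)\<^sup>2 \<le> \<kappa> * (norm v * C)\<^sup>2"
        using \<open>0 < \<kappa>\<close> by (intro mult_left_mono) auto
      also have "\<dots> = s\<^sup>2 * (\<epsilon>\<^sup>2 - s\<^sup>2) * (norm v)\<^sup>2"
        using \<open>0 < C\<close> by (simp add: \<kappa>_def power_mult_distrib)
      finally show ?thesis .
    qed
    ultimately show ?thesis by (simp add: algebra_simps)
  qed
  define \<delta> where "\<delta> = sqrt (\<epsilon>\<^sup>2 + \<kappa>) - \<epsilon>"
  have "\<epsilon> < sqrt (\<epsilon>\<^sup>2 + \<kappa>)"
    using \<open>0 < \<kappa>\<close> by (intro real_less_rsqrt) simp
  then obtain u where u: "norm (B u) < sqrt (\<epsilon>\<^sup>2 + \<kappa>) * norm u"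
    using inf[of \<delta>] by (auto simp: \<delta>_def)
  have "(norm (B u))\<^sup>2 < (sqrt (\<epsilon>\<^sup>2 + \<kappa>) * norm u)\<^sup>2"
    using u by (intro power_strict_mono) auto
  with gain[of u] \<open>0 < \<kappa>\<close> show False
    by (simp add: power_mult_distrib)
qed

section \<open>The transpose of a band operator\<close>

lemma entry_transpose_op:
  assumes "band_operator A"
  shows "entry (transpose_op A) i j = entry A j i"
proof -
  have "entry (transpose_op A) i j = (\<Sum>k. entry A k i * coord (unit_seq j) k)"
    using coord_transpose_op[OF assms] by (simp add: entry_def)
  also have "\<dots> = (\<Sum>k\<in>{j}. entry A k i * coord (unit_seq j) k)"
    by (rule suminf_finite) (auto simp: ell2_coords)
  finally show ?thesis by (simp add: ell2_coords)
qed

text \<open>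
  On multiples of unit sequences both sides are the same column sum of the matrix of \<open>A\<close>. Linearity
  and continuity in \<open>x\<close> extend this along finite truncations.
\<close>

lemma inner_band_operator:
  assumes A: "band_operator A"
  shows "inner (A x) y = inner x (cnj_seq (transpose_op A (cnj_seq y)))"
proof -
  define w where "w = cnj_seq (transpose_op A (cnj_seq y))"
  have bl: "bounded_linear A" and cl: "\<And>c x. A (cscale c x) = cscale c (A x)"
    using A by (auto simp: band_operator_def)
  have f: "bounded_linear (\<lambda>x. inner (A x) y)"
    by (rule bounded_linear_compose[OF bounded_linear_inner_left bl])
  have g: "bounded_linear (\<lambda>x. inner x w)"
    by (rule bounded_linear_inner_left)
  have basis: "inner (A (cscale c (unit_seq j))) y = inner (cscale c (unit_seq j)) w" for c j
  proof -
    have "inner (A (cscale c (unit_seq j))) y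
        = Re (\<Sum>k. c * (coord (A (unit_seq j)) k * cnj (coord y k)))"
      by (simp add: cl inner_ell2_Re ell2_coords mult.assoc)
    also have "\<dots> = Re (c * (\<Sum>k. coord (A (unit_seq j)) k * cnj (coord y k)))"
      by (simp add: suminf_mult summable_coord_mult_cnj)
    also have "(\<Sum>k. coord (A (unit_seq j)) k * cnj (coord y k)) = cnj (coord w j)"
      by (simp add: w_def ell2_coords coord_transpose_op[OF A] entry_def)
    also have "Re (c * cnj (coord w j))
        = Re (\<Sum>k\<in>{j}. coord (cscale c (unit_seq j)) k * cnj (coord w k))"
      by (simp add: ell2_coords)
    also have "\<dots> = inner (cscale c (unit_seq j)) w"
      unfolding inner_ell2_Re by (intro arg_cong[of _ _ Re] suminf_finite[symmetric])
        (auto simp: ell2_coords)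
    finally show ?thesis .
  qed
  let ?t = "\<lambda>n. \<Sum>j<n. cscale (coord x j) (unit_seq j)"
  have "inner (A (?t n)) y = inner (?t n) w" for n
    by (simp add: linear_sum[OF bounded_linear.linear[OF bl]] inner_sum_left basis)
  then have "(\<lambda>n. inner (A (?t n)) y) = (\<lambda>n. inner (?t n) w)" by simp
  moreover have "(\<lambda>n. inner (A (?t n)) y) \<longlonglongrightarrow> inner (A x) y"
    by (rule bounded_linear.tendsto[OF f truncation_tendsto])
  moreover have "(\<lambda>n. inner (?t n) w) \<longlonglongrightarrow> inner x w"
    by (rule bounded_linear.tendsto[OF g truncation_tendsto])
  ultimately show ?thesis
    unfolding w_def by (metis LIMSEQ_unique)
qed

text \<open>
  Additivity is seen on coordinates. The norm bound comes from adjointness: for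
  \<open>v\<close> the conjugate of the image of \<open>x\<close>, \<open>\<parallel>v\<parallel>\<^sup>2 = \<langle>A v, cnj x\<rangle> \<le> \<parallel>A\<parallel> \<parallel>v\<parallel> \<parallel>x\<parallel>\<close>.
\<close>

lemma bounded_linear_transpose_op:
  assumes A: "band_operator A"
  shows "bounded_linear (transpose_op A)"
proof (rule bounded_linear_intro[where K = "onorm A"])
  have bl: "bounded_linear A"
    using A by (auto simp: band_operator_def)
  note coords = ell2_eq_iff ell2_coords coord_transpose_op[OF A] entry_def
  fix x y :: ell2 and r :: real
  show "transpose_op A (x + y) = transpose_op A x + transpose_op A y"
    by (simp add: coords distrib_left suminf_add[OF summable_coord_mult summable_coord_mult])
  show "transpose_op A (r *\<^sub>R x) = r *\<^sub>R transpose_op A x"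
    by (simp add: coords suminf_scaleR_right[OF summable_coord_mult])
  define v where "v = cnj_seq (transpose_op A x)"
  have "(norm v)\<^sup>2 = inner v (cnj_seq (transpose_op A (cnj_seq (cnj_seq x))))"
    by (simp add: v_def power2_norm_eq_inner inner_cnj_seq)
  also have "\<dots> = inner (A v) (cnj_seq x)"
    by (rule inner_band_operator[OF A, symmetric])
  also have "\<dots> \<le> norm (A v) * norm x"
    using norm_cauchy_schwarz[of "A v" "cnj_seq x"] by simp
  also have "\<dots> \<le> onorm A * norm v * norm x"
    by (intro mult_right_mono onorm[OF bl]) auto
  finally have "norm v * norm v \<le> norm v * (norm x * onorm A)"
    by (simp add: power2_eq_square mult_ac)
  then have "norm v \<le> norm x * onorm A"
    using onorm_pos_le[OF bl] by (cases "v = 0") auto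
  then show "norm (transpose_op A x) \<le> norm x * onorm A"
    by (simp add: v_def)
qed

lemma transposed_pair_transpose_op:
  assumes "band_operator A"
  shows "transposed_pair A (transpose_op A)"
  using assms bounded_linear_transpose_op inner_band_operator
  by (simp add: transposed_pair_def band_operator_def)

lemma diagonal_offsets_transpose_op:
  assumes "band_operator A"
  shows "diagonal_offsets (transpose_op A) = diagonal_offsets A"
  unfolding diagonal_offsets_def entry_transpose_op[OF assms] by (metis abs_minus_commute)

lemma band_operator_transpose_op:
  assumes A: "band_operator A"
  shows "band_operator (transpose_op A)"
proof -
  have "transpose_op A (cscale c x) = cscale c (transpose_op A x)" for c x
    by (simp add: ell2_eq_iff ell2_coords coord_transpose_op[OF A] entry_def
        suminf_mult[OF summable_coord_mult, symmetric] mult.left_commute)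
  then show ?thesis
    using A bounded_linear_transpose_op[OF A] diagonal_offsets_transpose_op[OF A]
    by (simp add: band_operator_def)
qed

section \<open>Norms of the off-diagonal blocks\<close>

text \<open>
  A crude bound, which shows that the suprema defining the block norms are finite.
\<close>

lemma L2_set_matrix_le:
  fixes M :: "nat \<Rightarrow> nat \<Rightarrow> complex"
  assumes "\<And>r c. cmod (M r c) \<le> C"
  shows "L2_set (\<lambda>r. cmod (\<Sum>c<d. M r c * v c)) {..<d}
    \<le> real d * (real d * C) * L2_set (\<lambda>c. cmod (v c)) {..<d}"
proof -
  let ?L = "L2_set (\<lambda>c. cmod (v c)) {..<d}"
  have "0 \<le> C"
    using order_trans[OF norm_ge_zero assms] .
  have "cmod (\<Sum>c<d. M r c * v c) \<le> real d * (C * ?L)" for r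
  proof -
    have "cmod (\<Sum>c<d. M r c * v c) \<le> (\<Sum>c<d. C * ?L)"
    proof (rule sum_norm_le)
      fix c assume "c \<in> {..<d}"
      then have "cmod (v c) \<le> ?L"
        by (intro member_le_L2_set) auto
      then show "cmod (M r c * v c) \<le> C * ?L"
        unfolding norm_mult by (intro mult_mono assms \<open>0 \<le> C\<close>) auto
    qed
    then show ?thesis by simp
  qed
  then have "(\<Sum>r<d. cmod (\<Sum>c<d. M r c * v c)) \<le> (\<Sum>r<d. real d * (C * ?L))"
    by (intro sum_mono)
  then show ?thesis
    using L2_set_le_sum[of "{..<d}" "\<lambda>r. cmod (\<Sum>c<d. M r c * v c)"]
    by (simp add: mult.assoc)
qed

lemma
  fixes M :: "nat \<Rightarrow> nat \<Rightarrow> complex"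
  assumes "0 < d" and bound: "\<And>r c. cmod (M r c) \<le> C"
  shows matrix_norm_le: "matrix_norm d M \<le> real d * (real d * C)"
    and matrix_norm_nonneg: "0 \<le> matrix_norm d M"
    and L2_set_matrix_norm: "L2_set (\<lambda>r. cmod (\<Sum>c<d. M r c * v c)) {..<d}
      \<le> matrix_norm d M * L2_set (\<lambda>c. cmod (v c)) {..<d}"
proof -
  let ?L = "\<lambda>v. L2_set (\<lambda>c. cmod (v c)) {..<d}"
  let ?Mv = "\<lambda>v. L2_set (\<lambda>r. cmod (\<Sum>c<d. M r c * v c)) {..<d}"
  let ?X = "{?Mv v | v. ?L v = 1}"
  have norm: "matrix_norm d M = Sup ?X"
    by (simp add: matrix_norm_def)
  have le: "x \<le> real d * (real d * C)" if x: "x \<in> ?X" for x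
  proof -
    obtain v where "x = ?Mv v" "?L v = 1"
      using x by blast
    then show ?thesis
      using L2_set_matrix_le[where M = M and v = v and d = d, OF bound] by simp
  qed
  then have bdd: "bdd_above ?X" by (rule bdd_aboveI)
  have "(\<Sum>c<d. (cmod (if c = 0 then 1 else 0))\<^sup>2) = (\<Sum>c<d. if c = 0 then 1 else 0)"
    by (intro sum.cong) auto
  then have "?L (\<lambda>c. if c = 0 then 1 else 0) = 1"
    using \<open>0 < d\<close> by (simp add: L2_set_def)
  then obtain v0 where v0: "?L v0 = 1" by (rule that)
  then have mem: "?Mv v0 \<in> ?X" by blast
  show "matrix_norm d M \<le> real d * (real d * C)"
    unfolding norm using mem by (intro cSup_least le) blast
  show "0 \<le> matrix_norm d M"
    unfolding norm by (rule cSup_upper2[OF mem L2_set_nonneg bdd])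
  show "?Mv v \<le> matrix_norm d M * ?L v"
  proof (cases "?L v = 0")
    case True
    then have "?Mv v \<le> 0"
      using L2_set_matrix_le[where M = M and v = v and d = d, OF bound] by simp
    then show ?thesis by (simp add: True)
  next
    case False
    define l where "l = ?L v"
    have "0 < l" using False by (simp add: l_def less_le)
    define w where "w c = of_real (inverse l) * v c" for c
    have "?L w = inverse l * ?L v"
      using \<open>0 < l\<close> by (simp add: w_def norm_mult norm_inverse L2_set_right_distrib)
    then have "?L w = 1"
      using \<open>0 < l\<close> by (simp add: l_def[symmetric])
    then have "?Mv w \<le> matrix_norm d M"
      unfolding norm by (intro cSup_upper bdd) blast
    moreover have "(\<Sum>c<d. M r c * w c) = of_real (inverse l) * (\<Sum>c<d. M r c * v c)" for r
      by (simp add: w_def sum_distrib_left mult_ac)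
    then have "?Mv w = inverse l * ?Mv v"
      using \<open>0 < l\<close> by (simp add: norm_mult norm_inverse L2_set_right_distrib)
    ultimately have "inverse l * ?Mv v \<le> matrix_norm d M" by simp
    then show ?thesis
      using \<open>0 < l\<close> unfolding l_def[symmetric] by (simp add: divide_inverse_commute[symmetric] pos_divide_le_eq)
  qed
qed

text \<open>
  The transpose of a block has the same norm, by the duality \<open>\<parallel>p\<parallel>\<^sup>2 = \<Sum> v\<^sub>c q\<^sub>c\<close> with \<open>q\<close> the image of the
  conjugate of \<open>p\<close>. Hence passing to the transposed operator only exchanges the roles of the two
  off-diagonal bounds.
\<close>

lemma L2_set_transposed_matrix:
  fixes M :: "nat \<Rightarrow> nat \<Rightarrow> complex"
  assumes bound: "\<And>v. L2_set (\<lambda>r. cmod (\<Sum>c<d. M r c * v c)) {..<d}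
      \<le> a * L2_set (\<lambda>c. cmod (v c)) {..<d}"
  shows "L2_set (\<lambda>r. cmod (\<Sum>c<d. M c r * v c)) {..<d} \<le> a * L2_set (\<lambda>c. cmod (v c)) {..<d}"
proof -
  define p where "p r = (\<Sum>c<d. M c r * v c)" for r
  define q where "q c = (\<Sum>r<d. M c r * cnj (p r))" for c
  let ?p = "L2_set (\<lambda>r. cmod (p r)) {..<d}" and ?v = "L2_set (\<lambda>c. cmod (v c)) {..<d}"
  have "complex_of_real (?p\<^sup>2) = (\<Sum>r<d. p r * cnj (p r))"
    by (simp add: L2_set_def sum_nonneg complex_norm_square flip: of_real_power)
  also have "\<dots> = (\<Sum>r<d. \<Sum>c<d. v c * (M c r * cnj (p r)))"
    by (subst p_def) (simp add: sum_distrib_left mult_ac)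
  also have "\<dots> = (\<Sum>c<d. v c * q c)"
    by (subst sum.swap) (simp add: q_def sum_distrib_left)
  finally have "?p\<^sup>2 = cmod (\<Sum>c<d. v c * q c)"
    by (metis abs_of_nonneg norm_of_real zero_le_power2)
  also have "\<dots> \<le> (\<Sum>c<d. \<bar>cmod (v c)\<bar> * \<bar>cmod (q c)\<bar>)"
    by (rule sum_norm_le) (simp add: norm_mult)
  also have "\<dots> \<le> ?v * L2_set (\<lambda>c. cmod (q c)) {..<d}"
    by (rule L2_set_mult_ineq)
  also have "\<dots> \<le> ?v * (a * ?p)"
    unfolding q_def using bound[of "\<lambda>r. cnj (p r)"] by (intro mult_left_mono) auto
  finally have "?p * ?p \<le> ?p * (a * ?v)"
    by (simp add: power2_eq_square mult_ac)
  moreover have "0 \<le> a * ?v"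
    using order_trans[OF L2_set_nonneg bound] .
  ultimately have "?p \<le> a * ?v"
    by (cases "?p = 0") (auto simp: less_le)
  then show ?thesis by (simp add: p_def)
qed

lemma block_size_pos: "0 < block_size A"
  by (simp add: block_size_def)

lemma
  fixes A i
  assumes "band_operator A"
  defines "d \<equiv> block_size A"
  shows subdiag_block_bound: "L2_set (\<lambda>r. cmod (\<Sum>c<d. entry A (Suc i * d + r) (i * d + c) * v c)) {..<d}
      \<le> subdiag_norm A * L2_set (\<lambda>c. cmod (v c)) {..<d}" (is ?sub)
    and superdiag_block_bound: "L2_set (\<lambda>r. cmod (\<Sum>c<d. entry A (i * d + r) (Suc i * d + c) * v c)) {..<d}
      \<le> superdiag_norm A * L2_set (\<lambda>c. cmod (v c)) {..<d}" (is ?super)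
    and subdiag_norm_nonneg: "0 \<le> subdiag_norm A"
    and superdiag_norm_nonneg: "0 \<le> superdiag_norm A"
proof -
  have bl: "bounded_linear A"
    using assms(1) by (simp add: band_operator_def)
  have "0 < d" by (simp add: d_def block_size_pos)
  have bound: "cmod (block A k l r c) \<le> onorm A" for k l r c
    using cmod_entry_le[OF bl] by (simp add: block_def)
  have bdd: "bdd_above (range (\<lambda>k. matrix_norm d (block A (s k) (t k))))" for s t :: "nat \<Rightarrow> nat"
    using matrix_norm_le[OF \<open>0 < d\<close> bound] by (intro bdd_aboveI2)
  have sub: "matrix_norm d (block A (Suc k) k) \<le> subdiag_norm A" for k
    unfolding subdiag_norm_def d_def[symmetric] by (rule cSUP_upper[OF UNIV_I bdd])
  have super: "matrix_norm d (block A k (Suc k)) \<le> superdiag_norm A" for k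
    unfolding superdiag_norm_def d_def[symmetric] by (rule cSUP_upper[OF UNIV_I bdd])
  have entry: "entry A (k * d + r) (l * d + c) = block A k l r c" for k l r c
    by (simp add: block_def d_def)
  show ?sub
    unfolding entry using sub[of i]
    by (intro order_trans[OF L2_set_matrix_norm[OF \<open>0 < d\<close> bound]] mult_right_mono) auto
  show ?super
    unfolding entry using super[of i]
    by (intro order_trans[OF L2_set_matrix_norm[OF \<open>0 < d\<close> bound]] mult_right_mono) auto
  show "0 \<le> subdiag_norm A"
    using order_trans[OF matrix_norm_nonneg[OF \<open>0 < d\<close> bound] sub[of 0]] .
  show "0 \<le> superdiag_norm A"
    using order_trans[OF matrix_norm_nonneg[OF \<open>0 < d\<close> bound] super[of 0]] .
qed

lemma entry_block_tridiagonal: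
  assumes A: "band_operator A" and "entry A m j \<noteq> 0"
  shows "m div block_size A \<le> Suc (j div block_size A) \<and> j div block_size A \<le> Suc (m div block_size A)"
proof -
  define d where "d = block_size A"
  have "nat \<bar>int m - int j\<bar> \<le> bandwidth A"
    using entry_eq_0[OF A, of m j] assms(2) by (meson not_less)
  then have "m \<le> j + d" "j \<le> m + d"
    by (auto simp: d_def block_size_def split: if_splits)
  then have "m div d \<le> (j + d) div d" "j div d \<le> (m + d) div d"
    by (auto intro: div_le_mono)
  then show ?thesis
    using block_size_pos[of A] by (simp add: d_def)
qed

section \<open>Localisation by weighted windows\<close>

subsection \<open>The weights\<close>

text \<open>
  The sine weights form the eigenvector of the discrete Dirichlet Laplacian on \<open>{1..n}\<close> for its
  smallest eigenvalue \<open>2 - 2 cos \<theta> = (2 sin (\<theta> / 2))\<^sup>2\<close>, where \<open>\<theta> = \<pi> / (n + 1)\<close>. They minimise the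
  quotient of the sums of squares of differences and of values; this quotient is the square of the
  factor of \<open>\<parallel>\<alpha>\<parallel> + \<parallel>\<gamma>\<parallel>\<close> in \<open>\<epsilon>\<^sub>n\<close>.
\<close>

text \<open>
  Summation by parts against the recurrence of the sines; the boundary term vanishes when \<open>Suc m\<close>
  times \<open>\<theta>\<close> is a multiple of \<open>\<pi>\<close>.
\<close>

lemma sum_sin_diff_squares:
  "(\<Sum>i\<le>m. (sin (real (Suc i) * \<theta>) - sin (real i * \<theta>))\<^sup>2) =
    (2 - 2 * cos \<theta>) * (\<Sum>i\<le>m. (sin (real i * \<theta>))\<^sup>2)
    + sin (real (Suc m) * \<theta>) * (sin (real (Suc m) * \<theta>) - sin (real m * \<theta>))"
proof (induction m)
  case (Suc m)
  define p where "p = sin (real m * \<theta>)"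
  define q where "q = sin (real (Suc m) * \<theta>)"
  define s where "s = sin (real (Suc (Suc m)) * \<theta>)"
  have arg: "real (Suc (Suc m)) * \<theta> = real (Suc m) * \<theta> + \<theta>" "real m * \<theta> = real (Suc m) * \<theta> - \<theta>"
    by (simp_all add: algebra_simps)
  have rec: "p = 2 * cos \<theta> * q - s"
    unfolding p_def q_def s_def arg(1) arg(2) sin_add sin_diff by simp
  have "(s - q)\<^sup>2 + q * (q - p) = (2 - 2 * cos \<theta>) * q\<^sup>2 + s * (s - q)"
    unfolding rec by (simp add: power2_eq_square algebra_simps)
  with Suc show ?case
    unfolding p_def[symmetric] q_def[symmetric] s_def[symmetric] sum.atMost_Suc
    by (simp add: distrib_left)
qed (simp add: power2_eq_square)

text \<open>
  The argument is an integer because windows may start left of the first block: the weight of block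
  \<open>i\<close> in the window at position \<open>K\<close> is the value at \<open>i - K\<close>.
\<close>

definition window_weight :: "nat \<Rightarrow> int \<Rightarrow> real" where
  "window_weight n t = (if 0 \<le> t \<and> t \<le> int n + 1 then sin (of_int t * (pi / (real n + 1))) else 0)"

definition weight_mass :: "nat \<Rightarrow> real" where
  "weight_mass n = (\<Sum>i\<le>Suc n. (window_weight n (int i))\<^sup>2)"

lemma window_weight_eq_0:
  assumes "t \<le> 0 \<or> int n + 1 \<le> t"
  shows "window_weight n t = 0"
proof -
  have "t = 0 \<or> t = int n + 1" if "0 \<le> t" "t \<le> int n + 1"
    using assms that by auto
  then show ?thesis
    by (auto simp: window_weight_def)
qed

lemma window_weight_nat:
  "i \<le> Suc n \<Longrightarrow> window_weight n (int i) = sin (real i * (pi / (real n + 1)))"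
  by (simp add: window_weight_def)

lemma weight_mass_pos:
  assumes "1 \<le> n"
  shows "0 < weight_mass n"
proof -
  have "0 < sin (pi / (real n + 1))"
    using assms by (intro sin_gt_zero) (auto simp: field_simps)
  then have "0 < (window_weight n (int 1))\<^sup>2"
    by (subst window_weight_nat) auto
  also have "\<dots> \<le> weight_mass n"
    unfolding weight_mass_def by (rule member_le_sum) auto
  finally show ?thesis .
qed

lemma weight_differences:
  fixes n :: nat
  defines "\<tau> \<equiv> 2 * sin (pi / (2 * (real n + 1)))"
  shows "(\<Sum>i\<le>Suc n. (window_weight n (int i + 1) - window_weight n (int i))\<^sup>2)
      = \<tau>\<^sup>2 * weight_mass n" (is ?forward)
    and "(\<Sum>i\<le>Suc n. (window_weight n (int i - 1) - window_weight n (int i))\<^sup>2)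
      = \<tau>\<^sup>2 * weight_mass n" (is ?backward)
proof -
  define \<theta> where "\<theta> = pi / (real n + 1)"
  let ?D = "\<Sum>i\<le>n. (window_weight n (int (Suc i)) - window_weight n (int i))\<^sup>2"
  have "?D = (\<Sum>i\<le>n. (sin (real (Suc i) * \<theta>) - sin (real i * \<theta>))\<^sup>2)"
    by (intro sum.cong refl) (simp only: window_weight_nat \<theta>_def atMost_iff Suc_le_mono le_SucI)
  also have "\<dots> = (2 - 2 * cos \<theta>) * (\<Sum>i\<le>n. (sin (real i * \<theta>))\<^sup>2)"
    unfolding sum_sin_diff_squares by (simp add: \<theta>_def add.commute)
  also have "(\<Sum>i\<le>n. (sin (real i * \<theta>))\<^sup>2) = (\<Sum>i\<le>n. (window_weight n (int i))\<^sup>2)"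
    by (intro sum.cong refl) (simp add: window_weight_nat \<theta>_def)
  also have "\<dots> = weight_mass n"
    by (simp add: weight_mass_def window_weight_eq_0)
  also have "2 - 2 * cos \<theta> = \<tau>\<^sup>2"
  proof -
    have "\<tau> = 2 * sin (\<theta> / 2)"
      by (simp add: \<tau>_def \<theta>_def mult.commute)
    then show ?thesis
      using cos_double_sin[of "\<theta> / 2"] by (simp add: power_mult_distrib)
  qed
  finally have D: "?D = \<tau>\<^sup>2 * weight_mass n" .
  show ?forward
    using D by (simp add: window_weight_eq_0 add.commute)
  have "(\<Sum>i\<le>Suc n. (window_weight n (int i - 1) - window_weight n (int i))\<^sup>2) = ?D"
    by (subst sum.atMost_Suc_shift) (simp add: window_weight_eq_0 power2_commute)
  with D show ?backward by simp
qed

text \<open>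
  The range of window positions is large enough for every block \<open>I \<le> Q\<close> to pass through the whole
  window, so that the total weight a block receives does not depend on the block.
\<close>

lemma sum_window_positions:
  fixes G :: "int \<Rightarrow> real"
  assumes G: "\<And>t. t < 0 \<or> int n + 1 < t \<Longrightarrow> G t = 0" and "I \<le> Q"
  shows "(\<Sum>K\<in>{- int n - 1..int Q}. G (int I - K)) = (\<Sum>i\<le>Suc n. G (int i))"
proof -
  have "(\<Sum>i\<le>Suc n. G (int i)) = (\<Sum>K\<in>(\<lambda>i. int I - int i) ` {..Suc n}. G (int I - K))"
    by (subst sum.reindex) (auto simp: inj_on_def)
  also have "\<dots> = (\<Sum>K\<in>{- int n - 1..int Q}. G (int I - K))"
  proof (rule sum.mono_neutral_left)
    show "(\<lambda>i. int I - int i) ` {..Suc n} \<subseteq> {- int n - 1..int Q}"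
      using \<open>I \<le> Q\<close> by auto
    show "\<forall>K\<in>{- int n - 1..int Q} - (\<lambda>i. int I - int i) ` {..Suc n}. G (int I - K) = 0"
    proof
      fix K assume K: "K \<in> {- int n - 1..int Q} - (\<lambda>i. int I - int i) ` {..Suc n}"
      have "\<not> (0 \<le> int I - K \<and> int I - K \<le> int n + 1)"
      proof
        assume "0 \<le> int I - K \<and> int I - K \<le> int n + 1"
        then have "K = int I - int (nat (int I - K))" "nat (int I - K) \<le> Suc n" by auto
        with K show False by blast
      qed
      then show "G (int I - K) = 0" by (intro G) auto
    qed
  qed simp
  finally show ?thesis ..
qed

subsection \<open>Finitely supported sequences\<close>

definition fin_seq :: "nat \<Rightarrow> (nat \<Rightarrow> complex) \<Rightarrow> ell2" where
  "fin_seq N f = (\<Sum>j<N. cscale (f j) (unit_seq j))"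

lemma coord_fin_seq: "coord (fin_seq N f) i = (if i < N then f i else 0)"
  by (simp add: fin_seq_def coord_sum ell2_coords if_distrib cong: if_cong)

lemma coord_apply_fin_seq:
  assumes "bounded_linear B" and "\<And>c x. B (cscale c x) = cscale c (B x)"
  shows "coord (B (fin_seq N f)) m = (\<Sum>j<N. entry B m j * f j)"
  by (simp add: fin_seq_def linear_sum[OF bounded_linear.linear[OF assms(1)]] assms(2)
      coord_sum ell2_coords entry_def mult.commute)

lemma norm_finite_support:
  assumes "\<And>m. M \<le> m \<Longrightarrow> coord y m = 0"
  shows "norm y = L2_set (\<lambda>m. cmod (coord y m)) {..<M}"
proof -
  have "(\<Sum>m. (cmod (coord y m))\<^sup>2) = (\<Sum>m<M. (cmod (coord y m))\<^sup>2)"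
    using assms by (intro suminf_finite) (auto simp: not_less)
  then show ?thesis by (simp add: norm_ell2_def L2_set_def)
qed

lemma norm_fin_seq: "norm (fin_seq N f) = L2_set (\<lambda>m. cmod (f m)) {..<N}"
proof -
  have "norm (fin_seq N f) = L2_set (\<lambda>m. cmod (coord (fin_seq N f) m)) {..<N}"
    by (rule norm_finite_support) (simp add: coord_fin_seq)
  also have "\<dots> = L2_set (\<lambda>m. cmod (f m)) {..<N}"
    by (rule L2_set_cong) (simp_all add: coord_fin_seq)
  finally show ?thesis .
qed

text \<open>
  A strict inequality survives truncation. Working with finite supports makes all sums in the
  averaging argument finite.
\<close>

lemma finitely_supported_witness:
  assumes B: "bounded_linear B" and "norm (B x) < \<epsilon> * norm x" and "0 < d"
  obtains Q f where "norm (B (fin_seq (Q * d) f)) < \<epsilon> * norm (fin_seq (Q * d) f)"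
proof -
  let ?t = "\<lambda>n. fin_seq n (coord x)"
  have t: "?t \<longlonglongrightarrow> x"
    unfolding fin_seq_def by (rule truncation_tendsto)
  have "(\<lambda>n. \<epsilon> * norm (?t n) - norm (B (?t n))) \<longlonglongrightarrow> \<epsilon> * norm x - norm (B x)"
    by (intro tendsto_intros t bounded_linear.tendsto[OF B])
  then have "\<forall>\<^sub>F n in sequentially. 0 < \<epsilon> * norm (?t n) - norm (B (?t n))"
    using assms(2) by (intro order_tendstoD(1)) auto
  then obtain N where "\<And>n. N \<le> n \<Longrightarrow> 0 < \<epsilon> * norm (?t n) - norm (B (?t n))"
    unfolding eventually_sequentially by blast
  from this[of "N * d"] show ?thesis
    using \<open>0 < d\<close> by (intro that[of N "coord x"]) simp
qed

subsection \<open>Norms of block diagonals\<close>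

lemma sum_blocks: "(\<Sum>m<Q * d. h m) = (\<Sum>i<Q. \<Sum>r<d. h (i * d + r))"
  for h :: "nat \<Rightarrow> 'a::comm_monoid_add"
proof -
  have "(\<Sum>m<Q * d. h m) = (\<Sum>i<Q. sum h {i * d..<i * d + d})"
    by (rule sum.nat_group[symmetric])
  also have "\<dots> = (\<Sum>i<Q. \<Sum>r<d. h (i * d + r))"
  proof (rule sum.cong[OF refl])
    fix i
    show "sum h {i * d..<i * d + d} = (\<Sum>r<d. h (i * d + r))"
      using sum.shift_bounds_nat_ivl[of h 0 "i * d" d] by (simp add: add.commute lessThan_atLeast0)
  qed
  finally show ?thesis .
qed

text \<open>
  A block matrix whose nonzero blocks sit at the positions of a partial bijection \<open>R\<close>, such as a
  single block diagonal, maps different input blocks to different output blocks. Hence its norm is at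
  most the largest norm of a block.
\<close>

lemma block_diagonal_bound:
  fixes e :: "nat \<Rightarrow> nat \<Rightarrow> complex"
  assumes "0 \<le> a"
    and inj: "\<And>i i' k. R i k \<Longrightarrow> R i' k \<Longrightarrow> i = i'"
    and func: "\<And>i k k'. R i k \<Longrightarrow> R i k' \<Longrightarrow> k = k'"
    and bound: "\<And>i k v. R i k \<Longrightarrow>
      L2_set (\<lambda>r. cmod (\<Sum>c<d. e (k * d + r) (i * d + c) * v c)) {..<d}
        \<le> a * L2_set (\<lambda>c. cmod (v c)) {..<d}"
  shows "L2_set (\<lambda>m. cmod (\<Sum>j<Q * d. if R (j div d) (m div d) then e m j * f j else 0)) {..<Q' * d}
    \<le> a * L2_set (\<lambda>j. cmod (f j)) {..<Q * d}"
proof -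
  define T where "T m = (\<Sum>j<Q * d. if R (j div d) (m div d) then e m j * f j else 0)" for m
  define h where "h i = (\<Sum>c<d. (cmod (f (i * d + c)))\<^sup>2)" for i
  have "0 \<le> h i" for i by (simp add: h_def sum_nonneg)
  have T: "T (k * d + r) = (\<Sum>i<Q. if R i k then \<Sum>c<d. e (k * d + r) (i * d + c) * f (i * d + c) else 0)"
    if "r < d" for k r
    unfolding T_def sum_blocks using that by (intro sum.cong refl) simp
  have row: "(\<Sum>r<d. (cmod (T (k * d + r)))\<^sup>2) \<le> (\<Sum>i<Q. if R i k then a\<^sup>2 * h i else 0)" for k
  proof (cases "\<exists>i<Q. R i k")
    case True
    then obtain i where i: "i < Q" "R i k" by blast
    \<comment> \<open>At most one input block contributes to output block \<open>k\<close>.\<close>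
    have pick: "(\<Sum>i'<Q. if R i' k then F i' else 0) = F i" for F :: "nat \<Rightarrow> 'b::comm_monoid_add"
    proof -
      have "R i' k \<longleftrightarrow> i' = i" for i'
        using inj i(2) by blast
      then show ?thesis using i(1) by simp
    qed
    have "(L2_set (\<lambda>r. cmod (\<Sum>c<d. e (k * d + r) (i * d + c) * f (i * d + c))) {..<d})\<^sup>2
        \<le> (a * L2_set (\<lambda>c. cmod (f (i * d + c))) {..<d})\<^sup>2"
      by (intro power_mono bound i L2_set_nonneg)
    then have "(\<Sum>r<d. (cmod (\<Sum>c<d. e (k * d + r) (i * d + c) * f (i * d + c)))\<^sup>2) \<le> a\<^sup>2 * h i"
      by (simp add: L2_set_def power_mult_distrib h_def sum_nonneg)
    then show ?thesis
      by (simp add: T pick)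
  next
    case False
    then have "T (k * d + r) = 0" if "r < d" for r
      unfolding T[OF that] by (intro sum.neutral) auto
    then have "(\<Sum>r<d. (cmod (T (k * d + r)))\<^sup>2) = 0" by simp
    also have "\<dots> \<le> (\<Sum>i<Q. if R i k then a\<^sup>2 * h i else 0)"
      using \<open>\<And>i. 0 \<le> h i\<close> by (intro sum_nonneg) auto
    finally show ?thesis .
  qed
  have "(\<Sum>m<Q' * d. (cmod (T m))\<^sup>2) \<le> (\<Sum>k<Q'. \<Sum>i<Q. if R i k then a\<^sup>2 * h i else 0)"
    unfolding sum_blocks by (intro sum_mono row)
  also have "\<dots> = (\<Sum>i<Q. \<Sum>k<Q'. if R i k then a\<^sup>2 * h i else 0)"
    by (rule sum.swap)
  also have "\<dots> \<le> (\<Sum>i<Q. a\<^sup>2 * h i)"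
  proof (rule sum_mono)
    fix i
    show "(\<Sum>k<Q'. if R i k then a\<^sup>2 * h i else 0) \<le> a\<^sup>2 * h i"
    proof (cases "\<exists>k. R i k")
      case True
      then obtain k where "R i k" ..
      then have "R i k' \<longleftrightarrow> k' = k" for k'
        using func by blast
      then show ?thesis using \<open>0 \<le> h i\<close> by simp
    qed (use \<open>0 \<le> h i\<close> in simp)
  qed
  also have "\<dots> = a\<^sup>2 * (\<Sum>j<Q * d. (cmod (f j))\<^sup>2)"
    by (simp add: sum_blocks h_def sum_distrib_left)
  finally have "sqrt (\<Sum>m<Q' * d. (cmod (T m))\<^sup>2) \<le> sqrt (a\<^sup>2 * (\<Sum>j<Q * d. (cmod (f j))\<^sup>2))"
    by (rule real_sqrt_le_mono)
  then show ?thesis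
    using \<open>0 \<le> a\<close> by (simp add: L2_set_def real_sqrt_mult T_def)
qed

subsection \<open>The localisation estimate\<close>

text \<open>
  Averaging over all window positions: coordinate \<open>m\<close>, lying in block \<open>p m\<close>, meets each value of \<open>G\<close>
  exactly once, so the norm factorises.
\<close>

lemma L2_set_weighted:
  fixes G :: "int \<Rightarrow> real" and b :: "nat \<Rightarrow> complex" and p :: "nat \<Rightarrow> nat"
  assumes G: "\<And>t. t < 0 \<or> int n + 1 < t \<Longrightarrow> G t = 0" and p: "\<And>m. m < M \<Longrightarrow> p m \<le> Q"
  shows "L2_set (\<lambda>(K, m). \<bar>G (int (p m) - K)\<bar> * cmod (b m)) ({- int n - 1..int Q} \<times> {..<M})
    = sqrt (\<Sum>i\<le>Suc n. (G (int i))\<^sup>2) * L2_set (\<lambda>m. cmod (b m)) {..<M}"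
proof -
  let ?KS = "{- int n - 1..int Q}"
  have "(\<Sum>(K, m)\<in>?KS \<times> {..<M}. (\<bar>G (int (p m) - K)\<bar> * cmod (b m))\<^sup>2)
      = (\<Sum>m<M. \<Sum>K\<in>?KS. (G (int (p m) - K))\<^sup>2 * (cmod (b m))\<^sup>2)"
    by (simp add: sum.cartesian_product[symmetric] power_mult_distrib) (rule sum.swap)
  also have "\<dots> = (\<Sum>m<M. (\<Sum>i\<le>Suc n. (G (int i))\<^sup>2) * (cmod (b m))\<^sup>2)"
  proof (rule sum.cong[OF refl])
    fix m assume "m \<in> {..<M}"
    then have "(\<Sum>K\<in>?KS. (G (int (p m) - K))\<^sup>2) = (\<Sum>i\<le>Suc n. (G (int i))\<^sup>2)"
      using p G by (intro sum_window_positions[where G = "\<lambda>t. (G t)\<^sup>2"]) auto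
    then show "(\<Sum>K\<in>?KS. (G (int (p m) - K))\<^sup>2 * (cmod (b m))\<^sup>2)
        = (\<Sum>i\<le>Suc n. (G (int i))\<^sup>2) * (cmod (b m))\<^sup>2"
      by (simp only: sum_distrib_right[symmetric])
  qed
  finally show ?thesis
    by (simp only: L2_set_def case_prod_unfold sum_distrib_left[symmetric] real_sqrt_mult)
qed

lemma L2_set_Sigma:
  fixes h :: "'a \<Rightarrow> 'b \<Rightarrow> real"
  shows "L2_set (\<lambda>K. L2_set (h K) M) S = L2_set (\<lambda>(K, m). h K m) (S \<times> M)"
  by (simp add: L2_set_def sum_nonneg sum.cartesian_product case_prod_unfold)

text \<open>
  Multiply \<open>x\<close> by the weights of the window at position \<open>K\<close> to get \<open>y K\<close>. Since \<open>B\<close> is block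
  tridiagonal, \<open>B (y K)\<close> is the weighted \<open>B x\<close> plus commutator terms: the lower and the upper block
  diagonal of \<open>B\<close> applied to \<open>x\<close>, multiplied by differences of neighbouring weights. Take the Euclidean
  norm over all positions \<open>K\<close> and coordinates together. With \<open>S\<close> the sum of the squared weights and
  \<open>\<tau> = 2 sin (\<pi> / (2 (n + 1)))\<close> the square root of the quotient computed in \<open>weight_differences\<close>,
  Minkowski's inequality bounds it by \<open>\<surd>S (\<parallel>B x\<parallel> + \<tau> (a + g) \<parallel>x\<parallel>)\<close>, while the vectors \<open>y K\<close>
  together have norm \<open>\<surd>S \<parallel>x\<parallel>\<close>. So some window does at least as well as this average.
\<close>

lemma window_localisation:
  assumes B: "bounded_linear B" and cl: "\<And>c x. B (cscale c x) = cscale c (B x)"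
    and "0 < d"
    and tri: "\<And>m j. entry B m j \<noteq> 0 \<Longrightarrow> m div d \<le> Suc (j div d) \<and> j div d \<le> Suc (m div d)"
    and "0 \<le> a" and sub: "\<And>i v. L2_set (\<lambda>r. cmod (\<Sum>c<d. entry B (Suc i * d + r) (i * d + c) * v c)) {..<d}
        \<le> a * L2_set (\<lambda>c. cmod (v c)) {..<d}"
    and "0 \<le> g" and super: "\<And>i v. L2_set (\<lambda>r. cmod (\<Sum>c<d. entry B (i * d + r) (Suc i * d + c) * v c)) {..<d}
        \<le> g * L2_set (\<lambda>c. cmod (v c)) {..<d}"
    and "1 \<le> n" and x: "norm (B x) < \<epsilon> * norm x"
  shows "\<exists>k. \<exists>y\<in>block_window d n k.
    norm (B y) < (\<epsilon> + 2 * (a + g) * sin (pi / (2 * (real n + 1)))) * norm y"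
proof (rule ccontr)
  assume none: "\<not> ?thesis"
  define \<tau> where "\<tau> = 2 * sin (pi / (2 * (real n + 1)))"
  define \<eta> where "\<eta> = \<epsilon> + (a + g) * \<tau>"
  have "0 \<le> \<tau>"
    unfolding \<tau>_def using sin_ge_zero[of "pi / (2 * (real n + 1))"] by (simp add: field_simps)
  have \<eta>: "\<epsilon> + 2 * (a + g) * sin (pi / (2 * (real n + 1))) = \<eta>"
    by (simp add: \<eta>_def \<tau>_def)
  have none: "\<eta> * norm y \<le> norm (B y)" if "y \<in> block_window d n k" for y k
    using none that unfolding \<eta> by (meson not_less)
  obtain Q f where f: "norm (B (fin_seq (Q * d) f)) < \<epsilon> * norm (fin_seq (Q * d) f)"
    using finitely_supported_witness[OF B x \<open>0 < d\<close>] .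
  define N where "N = Q * d"
  define M where "M = Suc Q * d"
  define W where "W = window_weight n"
  define S where "S = weight_mass n"
  have "0 < \<epsilon>"
    using f by (metis norm_ge_zero mult_nonpos_nonneg not_less order_le_less_trans order_less_imp_le)
  have "0 \<le> \<eta>"
    using \<open>0 < \<epsilon>\<close> \<open>0 \<le> a\<close> \<open>0 \<le> g\<close> \<open>0 \<le> \<tau>\<close> by (simp add: \<eta>_def)
  have "0 < S"
    using weight_mass_pos[OF \<open>1 \<le> n\<close>] by (simp add: S_def)
  \<comment> \<open>\<open>b\<close> is \<open>B\<close> applied to the truncated vector; \<open>u\<close> and \<open>v\<close> are the contributions of the lower and the
     upper block diagonal. \<open>F\<close> and \<open>H\<close> are the weight differences that these acquire.\<close>
  define e where "e m j = entry B m j * f j" for m j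
  define b where "b m = (\<Sum>j<N. e m j)" for m
  define u where "u m = (\<Sum>j<N. if Suc (j div d) = m div d then e m j else 0)" for m
  define v where "v m = (\<Sum>j<N. if j div d = Suc (m div d) then e m j else 0)" for m
  define y where "y K = fin_seq N (\<lambda>j. complex_of_real (W (int (j div d) - K)) * f j)" for K
  define F where "F t = W (t - 1) - W t" for t
  define H where "H t = W (t + 1) - W t" for t
  define KS where "KS = {- int n - 1..int Q}"
  define nf where "nf = L2_set (\<lambda>j. cmod (f j)) {..<N}"
  have block_N: "j div d < Q" if "j < N" for j
    using that \<open>0 < d\<close> by (simp add: N_def div_less_iff_less_mult)
  have block_M: "m div d \<le> Q" if "m < M" for m
    using that \<open>0 < d\<close> unfolding M_def by (metis div_less_iff_less_mult less_Suc_eq_le)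
  have outside: "entry B m j = 0" if "j < N" "M \<le> m" for m j
  proof -
    have "Suc Q \<le> m div d"
      using \<open>0 < d\<close> that(2) by (simp add: M_def less_eq_div_iff_mult_less_eq del: mult_Suc)
    with tri[of m j] block_N[OF that(1)] show ?thesis by fastforce
  qed
  have normB: "norm (B (fin_seq N w)) = L2_set (\<lambda>m. cmod (coord (B (fin_seq N w)) m)) {..<M}" for w
    by (rule norm_finite_support) (simp add: coord_apply_fin_seq[OF B cl] outside)

  \<comment> \<open>The commutator identity, checked for each matrix entry according to the block diagonal it lies on.\<close>
  have coordB: "coord (B (y K)) m
      = of_real (W (int (m div d) - K)) * b m + of_real (F (int (m div d) - K)) * u m
        + of_real (H (int (m div d) - K)) * v m" for K m
  proof -
    have "coord (B (y K)) m = (\<Sum>j<N. of_real (W (int (j div d) - K)) * e m j)"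
      unfolding y_def coord_apply_fin_seq[OF B cl] by (simp add: e_def mult_ac)
    also have "\<dots> = (\<Sum>j<N. of_real (W (int (m div d) - K)) * e m j
        + of_real (F (int (m div d) - K)) * (if Suc (j div d) = m div d then e m j else 0)
        + of_real (H (int (m div d) - K)) * (if j div d = Suc (m div d) then e m j else 0))"
    proof (rule sum.cong[OF refl])
      fix j
      let ?i = "m div d" and ?j = "j div d"
      consider "e m j = 0" | "?j = ?i" | "Suc ?j = ?i" | "?j = Suc ?i"
        using tri[of m j] by (force simp: e_def)
      then show "of_real (W (int ?j - K)) * e m j = of_real (W (int ?i - K)) * e m j
        + of_real (F (int ?i - K)) * (if Suc ?j = ?i then e m j else 0)
        + of_real (H (int ?i - K)) * (if ?j = Suc ?i then e m j else 0)"
      proof cases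
        case 3
        then have "int ?j - K = int ?i - K - 1" by linarith
        then have "W (int ?j - K) = W (int ?i - K - 1)" by (rule arg_cong)
        with 3 show ?thesis by (simp add: F_def algebra_simps)
      next
        case 4
        then have "int ?j - K = int ?i - K + 1" by linarith
        then have "W (int ?j - K) = W (int ?i - K + 1)" by (rule arg_cong)
        with 4 show ?thesis by (simp add: H_def algebra_simps)
      qed auto
    qed
    also have "\<dots> = of_real (W (int (m div d) - K)) * b m + of_real (F (int (m div d) - K)) * u m
        + of_real (H (int (m div d) - K)) * v m"
      by (simp only: sum.distrib sum_distrib_left[symmetric] b_def u_def v_def)
    finally show ?thesis .
  qed

  have nf: "norm (fin_seq N f) = nf"
    by (simp add: nf_def norm_fin_seq)
  have u: "L2_set (\<lambda>m. cmod (u m)) {..<M} \<le> a * nf"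
    unfolding u_def e_def M_def N_def nf_def
    by (rule block_diagonal_bound[OF \<open>0 \<le> a\<close>]) (use sub in auto)
  have v: "L2_set (\<lambda>m. cmod (v m)) {..<M} \<le> g * nf"
    unfolding v_def e_def M_def N_def nf_def
    by (rule block_diagonal_bound[OF \<open>0 \<le> g\<close>]) (use super in auto)
  have b: "L2_set (\<lambda>m. cmod (b m)) {..<M} = norm (B (fin_seq N f))"
    unfolding normB by (simp add: coord_apply_fin_seq[OF B cl] b_def e_def)

  \<comment> \<open>A window that starts left of block \<open>0\<close> is contained in the one that starts at block \<open>0\<close>, whence the
     truncation by \<open>nat\<close>.\<close>
  have window: "\<eta> * norm (y K) \<le> norm (B (y K))" for K
  proof (rule none)
    show "y K \<in> block_window d n (nat (K + 1))"
    proof -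
      have "m div d \<in> {nat (K + 1)..<nat (K + 1) + n}" if "coord (y K) m \<noteq> 0" for m
      proof -
        have "W (int (m div d) - K) \<noteq> 0"
          using that by (auto simp: y_def coord_fin_seq split: if_splits)
        then have "0 < int (m div d) - K" "int (m div d) - K < int n + 1"
          using window_weight_eq_0[of "int (m div d) - K" n] by (force simp: W_def)+
        then show ?thesis by auto
      qed
      then show ?thesis by (auto simp: block_window_def)
    qed
  qed

  let ?P = "KS \<times> {..<M}"
  have W: "W t = 0" "F t = 0" "H t = 0" if "t < 0 \<or> int n + 1 < t" for t
    using that by (auto simp: W_def F_def H_def window_weight_eq_0)
  have lower: "\<eta> * (sqrt S * nf) \<le> L2_set (\<lambda>K. norm (B (y K))) KS"
  proof -
    have "sqrt S * nf = L2_set (\<lambda>(K, m). \<bar>W (int (m div d) - K)\<bar> * cmod (f m)) (KS \<times> {..<N})"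
      unfolding KS_def nf_def S_def weight_mass_def W_def[symmetric]
      using W(1) by (intro L2_set_weighted[symmetric]) (auto dest: block_N)
    also have "\<dots> = L2_set (\<lambda>K. norm (y K)) KS"
      unfolding y_def norm_fin_seq norm_mult norm_of_real by (rule L2_set_Sigma[symmetric])
    finally have "\<eta> * (sqrt S * nf) = L2_set (\<lambda>K. \<eta> * norm (y K)) KS"
      using \<open>0 \<le> \<eta>\<close> by (simp add: L2_set_right_distrib)
    also have "\<dots> \<le> L2_set (\<lambda>K. norm (B (y K))) KS"
      using \<open>0 \<le> \<eta>\<close> by (intro L2_set_mono window) auto
    finally show ?thesis .
  qed
  have "L2_set (\<lambda>K. norm (B (y K))) KS = L2_set (\<lambda>(K, m). cmod (coord (B (y K)) m)) ?P"
    unfolding y_def normB by (rule L2_set_Sigma)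
  also have "\<dots> \<le> L2_set (\<lambda>km. (case km of (K, m) \<Rightarrow> \<bar>W (int (m div d) - K)\<bar> * cmod (b m))
      + ((case km of (K, m) \<Rightarrow> \<bar>F (int (m div d) - K)\<bar> * cmod (u m))
        + (case km of (K, m) \<Rightarrow> \<bar>H (int (m div d) - K)\<bar> * cmod (v m)))) ?P"
  proof (rule L2_set_mono)
    fix km
    show "(case km of (K, m) \<Rightarrow> cmod (coord (B (y K)) m))
        \<le> (case km of (K, m) \<Rightarrow> \<bar>W (int (m div d) - K)\<bar> * cmod (b m))
      + ((case km of (K, m) \<Rightarrow> \<bar>F (int (m div d) - K)\<bar> * cmod (u m))
        + (case km of (K, m) \<Rightarrow> \<bar>H (int (m div d) - K)\<bar> * cmod (v m)))"
      unfolding coordB case_prod_unfold add.assoc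
      by (intro order_trans[OF norm_triangle_ineq] add_mono) (simp_all add: norm_mult)
  qed (auto split: prod.split)
  also have "\<dots> \<le> L2_set (\<lambda>(K, m). \<bar>W (int (m div d) - K)\<bar> * cmod (b m)) ?P
      + (L2_set (\<lambda>(K, m). \<bar>F (int (m div d) - K)\<bar> * cmod (u m)) ?P
        + L2_set (\<lambda>(K, m). \<bar>H (int (m div d) - K)\<bar> * cmod (v m)) ?P)"
    by (intro order_trans[OF L2_set_triangle_ineq] add_mono order_refl)
  also have "\<dots> = sqrt S * L2_set (\<lambda>m. cmod (b m)) {..<M}
      + (\<tau> * sqrt S * L2_set (\<lambda>m. cmod (u m)) {..<M} + \<tau> * sqrt S * L2_set (\<lambda>m. cmod (v m)) {..<M})"
  proof -
    have "(\<Sum>i\<le>Suc n. (W (int i))\<^sup>2) = S" "(\<Sum>i\<le>Suc n. (F (int i))\<^sup>2) = \<tau>\<^sup>2 * S"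
        "(\<Sum>i\<le>Suc n. (H (int i))\<^sup>2) = \<tau>\<^sup>2 * S"
      unfolding W_def F_def H_def S_def \<tau>_def by (simp_all only: weight_differences weight_mass_def)
    moreover have "sqrt (\<tau>\<^sup>2 * S) = \<tau> * sqrt S"
      using \<open>0 \<le> \<tau>\<close> by (simp add: real_sqrt_mult)
    moreover have "L2_set (\<lambda>(K, m). \<bar>G (int (m div d) - K)\<bar> * cmod (c m)) ?P
        = sqrt (\<Sum>i\<le>Suc n. (G (int i))\<^sup>2) * L2_set (\<lambda>m. cmod (c m)) {..<M}"
      if "\<And>t. t < 0 \<or> int n + 1 < t \<Longrightarrow> G t = 0" for G :: "int \<Rightarrow> real" and c :: "nat \<Rightarrow> complex"
      unfolding KS_def using that block_M by (rule L2_set_weighted)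
    ultimately show ?thesis
      by (simp only: W)
  qed
  also have "\<dots> \<le> sqrt S * norm (B (fin_seq N f)) + (\<tau> * sqrt S * (a * nf) + \<tau> * sqrt S * (g * nf))"
    unfolding b using u v \<open>0 \<le> \<tau>\<close> \<open>0 < S\<close> by (intro add_mono mult_left_mono) auto
  also have "\<dots> < sqrt S * (\<epsilon> * nf) + (\<tau> * sqrt S * (a * nf) + \<tau> * sqrt S * (g * nf))"
    using f \<open>0 < S\<close> by (simp add: nf N_def[symmetric])
  also have "\<dots> = \<eta> * (sqrt S * nf)"
    by (simp add: \<eta>_def algebra_simps)
  finally show False
    using lower by simp
qed

section \<open>Convergence of sublevel sets\<close>

text \<open>
  For subsets of a bounded set, pointwise exhaustion suffices: a finite net of the limit set is
  eventually contained in the approximating sets, even if these are not monotone in \<open>n\<close>.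
\<close>

lemma hausdorff_converges_from_below:
  fixes T :: "complex set"
  assumes "T \<noteq> {}" "bounded T"
    and sub: "\<And>n. 1 \<le> n \<Longrightarrow> S n \<subseteq> T"
    and pointwise: "\<And>t. t \<in> T \<Longrightarrow> \<forall>\<^sub>F n in sequentially. t \<in> S n"
  shows "hausdorff_converges S T"
  unfolding hausdorff_converges_def
proof (intro conjI)
  obtain t0 where "t0 \<in> T" using \<open>T \<noteq> {}\<close> by blast
  have ev_ne: "\<forall>\<^sub>F n in sequentially. t0 \<in> S n \<and> 1 \<le> n"
    using pointwise[OF \<open>t0 \<in> T\<close>] eventually_ge_at_top[of 1] by (rule eventually_conj)
  show "\<forall>\<^sub>F n in sequentially. S n \<noteq> {} \<and> bounded (S n)"
    using ev_ne by (rule eventually_mono) (use sub bounded_subset[OF \<open>bounded T\<close>] in blast)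
  show "(\<lambda>n. hausdorff_dist (S n) T) \<longlonglongrightarrow> 0"
  proof (rule LIMSEQ_I)
    fix e :: real assume "0 < e"
    have "compact (closure T)"
      using \<open>bounded T\<close> by (simp add: compact_closure)
    moreover have "closure T \<subseteq> (\<Union>t\<in>T. ball t (e / 2))"
    proof
      fix x assume "x \<in> closure T"
      then obtain t where "t \<in> T" "dist t x < e / 2"
        using \<open>0 < e\<close> unfolding closure_approachable by (meson half_gt_zero)
      then show "x \<in> (\<Union>t\<in>T. ball t (e / 2))" by auto
    qed
    ultimately obtain D where D: "D \<subseteq> T" "finite D" "closure T \<subseteq> (\<Union>t\<in>D. ball t (e / 2))"
      using compactE_image[of "closure T" T "\<lambda>t. ball t (e / 2)"] by auto
    have "\<forall>\<^sub>F n in sequentially. \<forall>t\<in>D. t \<in> S n"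
      using D(1) by (intro eventually_ball_finite D(2) ballI pointwise) auto
    with ev_ne have "\<forall>\<^sub>F n in sequentially. norm (hausdorff_dist (S n) T - 0) < e"
    proof eventually_elim
      case (elim n)
      have "infdist t (S n) \<le> e / 2" if "t \<in> T" for t
      proof -
        have "t \<in> (\<Union>s\<in>D. ball s (e / 2))"
          using D(3) closure_subset[of T] that by blast
        then obtain s where "s \<in> D" "dist s t < e / 2" by auto
        then show ?thesis
          using elim by (intro order_trans[OF infdist_le[of s]]) (auto simp: dist_commute)
      qed
      then have "(SUP t\<in>T. infdist t (S n)) \<le> e / 2"
        using \<open>T \<noteq> {}\<close> by (intro cSUP_least)
      moreover have "(SUP s\<in>S n. infdist s T) = (SUP s\<in>S n. 0)"
        using sub elim by (intro SUP_cong refl) (auto intro: infdist_zero)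
      then have "(SUP s\<in>S n. infdist s T) = 0"
        using elim by (metis cSUP_const empty_iff)
      ultimately show ?case
        using \<open>0 < e\<close> by (simp add: hausdorff_dist_def max_def)
    qed
    then show "\<exists>N. \<forall>n\<ge>N. norm (hausdorff_dist (S n) T - 0) < e"
      by (simp add: eventually_sequentially)
  qed
qed (use assms in auto)

text \<open>
  These three properties of the reciprocal of the resolvent norm are all that the convergence proof
  needs. The last one excludes positive local minima and in particular plateaus, at which the
  sublevel sets would jump.
\<close>

locale pseudospectral_landscape =
  fixes \<mu> :: "complex \<Rightarrow> real"
  assumes continuous: "continuous_on UNIV \<mu>"
    and coercive: "bounded {z. \<mu> z < c}"
    and no_positive_local_minimum: "0 < \<mu> z \<Longrightarrow> 0 < r \<Longrightarrow> \<exists>w. cmod (w - z) < r \<and> \<mu> w < \<mu> z"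
begin

lemma compact_sublevel: "closed K \<Longrightarrow> compact ({z. \<mu> z \<le> c} \<inter> K)"
proof -
  assume "closed K"
  have "bounded {z. \<mu> z \<le> c}"
    using coercive[of "c + 1"] by (rule bounded_subset) auto
  moreover have "closed {z. \<mu> z \<le> c}"
    by (intro closed_Collect_le continuous continuous_intros)
  ultimately show ?thesis
    using \<open>closed K\<close> by (simp add: compact_eq_bounded_closed bounded_Int closed_Int)
qed

text \<open>
  A coercive continuous function has a global minimum, which cannot be positive. For operators this
  is the nonemptiness of the spectrum.
\<close>

lemma sublevel_nonempty:
  assumes "0 < \<epsilon>"
  shows "{z. \<mu> z < \<epsilon>} \<noteq> {}"
proof
  assume empty: "{z. \<mu> z < \<epsilon>} = {}"
  have "compact {z. \<mu> z \<le> \<mu> 0}"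
    using compact_sublevel[of UNIV] by simp
  moreover have "{z. \<mu> z \<le> \<mu> 0} \<noteq> {}" by blast
  ultimately obtain z where z: "\<mu> z \<le> \<mu> 0" "\<And>w. \<mu> w \<le> \<mu> 0 \<Longrightarrow> \<mu> z \<le> \<mu> w"
    using continuous_attains_inf[of "{z. \<mu> z \<le> \<mu> 0}" \<mu>] continuous_on_subset[OF continuous] by auto
  have "0 < \<mu> z"
    using empty \<open>0 < \<epsilon>\<close> by (metis (mono_tags) empty_Collect_eq not_less order_less_le_trans)
  then obtain w where "\<mu> w < \<mu> z"
    using no_positive_local_minimum[of z 1] by auto
  then show False
    using z by (meson less_le_trans not_less order_less_imp_le)
qed

lemma level_set_subset_closure:
  assumes "\<mu> z \<le> \<epsilon>" "0 < \<epsilon>"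
  shows "z \<in> closure {z. \<mu> z < \<epsilon>}"
  unfolding closure_approachable
proof (intro allI impI)
  fix r :: real assume "0 < r"
  show "\<exists>w\<in>{z. \<mu> z < \<epsilon>}. dist w z < r"
  proof (cases "0 < \<mu> z")
    case True
    then show ?thesis
      using no_positive_local_minimum[OF True \<open>0 < r\<close>] assms(1) by (force simp: dist_norm)
  next
    case False
    then show ?thesis
      using assms(2) \<open>0 < r\<close> by (intro bexI[of _ z]) auto
  qed
qed

text \<open>
  On the compact set of points far from the sublevel set but below level \<open>\<epsilon> + 1\<close>, the function attains
  a minimum. It exceeds \<open>\<epsilon>\<close>, because points of level \<open>\<epsilon>\<close> are in the closure of the sublevel set.
\<close>

lemma sublevel_close:
  assumes "0 < \<epsilon>" "0 < \<eta>"
  obtains \<delta> where "0 < \<delta>" "\<And>z. \<mu> z < \<epsilon> + \<delta> \<Longrightarrow> infdist z {z. \<mu> z < \<epsilon>} < \<eta>"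
proof -
  let ?T = "{z. \<mu> z < \<epsilon>}"
  let ?K = "{z. \<mu> z \<le> \<epsilon> + 1} \<inter> {z. \<eta> \<le> infdist z ?T}"
  have "compact ?K"
    by (intro compact_sublevel closed_Collect_le continuous_intros)
  show ?thesis
  proof (cases "?K = {}")
    case True
    show ?thesis
    proof (rule that[of 1])
      fix z assume "\<mu> z < \<epsilon> + 1"
      with True show "infdist z ?T < \<eta>"
        by (metis (mono_tags, lifting) IntI empty_iff mem_Collect_eq not_less order_less_imp_le)
    qed simp
  next
    case False
    obtain z0 where z0: "z0 \<in> ?K" "\<And>z. z \<in> ?K \<Longrightarrow> \<mu> z0 \<le> \<mu> z"
      using continuous_attains_inf[OF \<open>compact ?K\<close> False continuous_on_subset[OF continuous]] by auto
    have "\<epsilon> < \<mu> z0"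
    proof (rule ccontr)
      assume "\<not> \<epsilon> < \<mu> z0"
      then have "infdist z0 ?T = 0"
        using level_set_subset_closure[of z0 \<epsilon>] \<open>0 < \<epsilon>\<close> sublevel_nonempty[OF \<open>0 < \<epsilon>\<close>]
        by (simp add: in_closure_iff_infdist_zero)
      with z0(1) \<open>0 < \<eta>\<close> show False by simp
    qed
    then show ?thesis
    proof (intro that[of "min 1 (\<mu> z0 - \<epsilon>)"])
      fix z assume "\<mu> z < \<epsilon> + min 1 (\<mu> z0 - \<epsilon>)"
      then have "\<mu> z \<le> \<epsilon> + 1" "\<mu> z < \<mu> z0" by auto
      then show "infdist z ?T < \<eta>"
        using z0(2)[of z] by (force simp: not_less)
    qed auto
  qed
qed

lemma hausdorff_converges_from_above:
  assumes "0 < \<epsilon>" and e: "e \<longlonglongrightarrow> 0"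
    and super: "\<And>n. 1 \<le> n \<Longrightarrow> {z. \<mu> z < \<epsilon>} \<subseteq> S n"
    and sub: "\<And>n. 1 \<le> n \<Longrightarrow> S n \<subseteq> {z. \<mu> z < \<epsilon> + e n}"
  shows "hausdorff_converges S {z. \<mu> z < \<epsilon>}"
  unfolding hausdorff_converges_def
proof (intro conjI)
  let ?T = "{z. \<mu> z < \<epsilon>}"
  show ne: "?T \<noteq> {}" and "bounded ?T"
    using sublevel_nonempty[OF \<open>0 < \<epsilon>\<close>] coercive by auto
  show "\<forall>\<^sub>F n in sequentially. S n \<noteq> {} \<and> bounded (S n)"
    using eventually_ge_at_top[of 1]
  proof eventually_elim
    case (elim n)
    show ?case
      using super[OF elim] ne bounded_subset[OF coercive sub[OF elim]] by blast
  qed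
  show "(\<lambda>n. hausdorff_dist (S n) ?T) \<longlonglongrightarrow> 0"
  proof (rule LIMSEQ_I)
    fix r :: real assume "0 < r"
    then obtain \<delta> where \<delta>: "0 < \<delta>" "\<And>z. \<mu> z < \<epsilon> + \<delta> \<Longrightarrow> infdist z ?T < r / 2"
      using sublevel_close[OF \<open>0 < \<epsilon>\<close>, of "r / 2"] by auto
    have "\<forall>\<^sub>F n in sequentially. e n < \<delta>"
      using e \<delta>(1) by (rule order_tendstoD)
    then have "\<forall>\<^sub>F n in sequentially. norm (hausdorff_dist (S n) ?T - 0) < r"
      using eventually_ge_at_top[of 1]
    proof eventually_elim
      case (elim n)
      have "infdist z ?T \<le> r / 2" if "z \<in> S n" for z
        using sub[OF elim(2)] that elim(1) by (intro less_imp_le \<delta>(2)) auto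
      moreover have "S n \<noteq> {}"
        using super[OF elim(2)] ne by blast
      ultimately have "(SUP z\<in>S n. infdist z ?T) \<le> r / 2"
        by (intro cSUP_least) auto
      moreover have "(SUP t\<in>?T. infdist t (S n)) = (SUP t\<in>?T. 0)"
        using super[OF elim(2)] by (intro SUP_cong refl) (auto intro: infdist_zero)
      then have "(SUP t\<in>?T. infdist t (S n)) = 0"
        using ne by auto
      ultimately show ?case
        using \<open>0 < r\<close> by (simp add: hausdorff_dist_def max_def)
    qed
    then show "\<exists>N. \<forall>n\<ge>N. norm (hausdorff_dist (S n) ?T - 0) < r"
      by (simp add: eventually_sequentially)
  qed
qed

end

section \<open>The pseudospectral landscape of a band operator\<close>

lemma lower_norm_shift_lipschitz:
  assumes B: "bounded_linear B"
  shows "lower_norm_on UNIV (shift_op B z) \<le> lower_norm_on UNIV (shift_op B w) + cmod (z - w)"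
proof (rule dense_ge)
  fix c assume "lower_norm_on UNIV (shift_op B w) + cmod (z - w) < c"
  then have "lower_norm_on UNIV (shift_op B w) < c - cmod (z - w)" by simp
  then obtain x where x: "norm (shift_op B w x) < (c - cmod (z - w)) * norm x"
    unfolding lower_norm_less_iff[OF bounded_linear_shift_op[OF B]] ..
  have "shift_op B z x = shift_op B w x - cscale (z - w) x"
    using cscale_algebra(3)[of w "z - w" x] by (simp add: shift_op_def)
  then have "norm (shift_op B z x) \<le> norm (shift_op B w x) + cmod (z - w) * norm x"
    using norm_triangle_ineq4[of "shift_op B w x" "cscale (z - w) x"] by (simp add: norm_cscale)
  with x have "norm (shift_op B z x) < c * norm x"
    by (simp add: left_diff_distrib)
  then show "lower_norm_on UNIV (shift_op B z) \<le> c"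
    using lower_norm_less_iff[OF bounded_linear_shift_op[OF B]] by (meson less_imp_le)
qed

lemma continuous_on_lower_norm_shift:
  assumes "bounded_linear B"
  shows "continuous_on UNIV (\<lambda>z. lower_norm_on UNIV (shift_op B z))"
proof (rule lipschitz_on_continuous_on)
  show "1-lipschitz_on UNIV (\<lambda>z. lower_norm_on UNIV (shift_op B z))"
  proof (rule lipschitz_onI)
    fix z w
    show "dist (lower_norm_on UNIV (shift_op B z)) (lower_norm_on UNIV (shift_op B w)) \<le> 1 * dist z w"
      using lower_norm_shift_lipschitz[OF assms, of z w] lower_norm_shift_lipschitz[OF assms, of w z]
      by (simp add: dist_norm norm_minus_commute[of w z] abs_le_iff)
  qed simp
qed

text \<open>
  For large \<open>\<bar>z\<bar>\<close> the shift dominates, \<open>\<parallel>B x - z x\<parallel> \<ge> (\<bar>z\<bar> - \<parallel>B\<parallel>) \<parallel>x\<parallel>\<close>.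
\<close>

lemma cmod_less_if_lower_norm_less:
  assumes B: "bounded_linear B" and "lower_norm_on UNIV (shift_op B z) < c"
  shows "cmod z < c + onorm B"
proof -
  obtain x where x: "norm (shift_op B z x) < c * norm x"
    using assms(2) unfolding lower_norm_less_iff[OF bounded_linear_shift_op[OF B]] ..
  have "cmod z * norm x \<le> norm (shift_op B z x) + norm (B x)"
    using norm_triangle_ineq4[of "B x" "shift_op B z x"] by (simp add: shift_op_def norm_cscale)
  also have "\<dots> < c * norm x + onorm B * norm x"
    using x onorm[OF B] by (intro add_less_le_mono)
  finally have "cmod z * norm x < (c + onorm B) * norm x"
    by (simp add: distrib_right)
  then show ?thesis
    by (rule mult_right_less_imp_less) simp
qed

text \<open>
  Positivity for the transpose supplies the surjectivity that the averaging argument requires.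
\<close>

lemma lower_norm_shift_no_local_minimum:
  assumes pair: "transposed_pair B C" and cl: "\<And>c x. B (cscale c x) = cscale c (B x)"
    and B: "0 < lower_norm_on UNIV (shift_op B z)" and C: "0 < lower_norm_on UNIV (shift_op C z)"
    and "0 < r"
  shows "\<exists>w. cmod (w - z) < r \<and> lower_norm_on UNIV (shift_op B w) < lower_norm_on UNIV (shift_op B z)"
proof -
  define \<epsilon> where "\<epsilon> = lower_norm_on UNIV (shift_op B z)"
  note bl = bounded_linear_shift_op[OF transposed_pairD(1)[OF pair]]
    bounded_linear_shift_op[OF transposed_pairD(2)[OF pair]]
  have "lower_norm_on UNIV (shift_op C z) * norm y \<le> norm (shift_op C z y)" for y
    using lower_norm_less_iff[OF bl(2)] by (meson not_less order_less_irrefl)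
  then have "surj (shift_op B z)"
    using surj_if_transpose_bounded_below[OF transposed_pair_shift_op[OF pair] C] by blast
  moreover have "shift_op B z (cscale c x) = cscale c (shift_op B z x)" for c x
    by (simp add: shift_op_def cl cscale_algebra mult.commute)
  moreover have "\<exists>u. norm (shift_op B z u) < (\<epsilon> + \<delta>) * norm u" if "0 < \<delta>" for \<delta>
    using that lower_norm_less_iff[OF bl(1), of z "\<epsilon> + \<delta>"] by (simp add: \<epsilon>_def)
  ultimately obtain h x where h: "cmod h < r" "norm (shift_op (shift_op B z) h x) < \<epsilon> * norm x"
    using shifted_lower_norm_decreases[OF bl(1)] B \<open>0 < r\<close> unfolding \<epsilon>_def[symmetric] by blast
  then have "lower_norm_on UNIV (shift_op B (z + h)) < \<epsilon>"
    using lower_norm_less_iff[OF bl(1)] by (auto simp: shift_op_shift_op)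
  with h(1) show ?thesis
    unfolding \<epsilon>_def by (intro exI[of _ "z + h"]) simp
qed

text \<open>
  The resolvent norm is infinite as soon as one of the two lower norms vanishes: the first one
  misses points at which the shifted operator is bounded below but not surjective.
\<close>

definition reciprocal_resolvent_norm :: "(ell2 \<Rightarrow> ell2) \<Rightarrow> complex \<Rightarrow> real" where
  "reciprocal_resolvent_norm A z =
    min (lower_norm_on UNIV (shift_op A z)) (lower_norm_on UNIV (shift_op (transpose_op A) z))"

lemma pseudospectrum_eq_sublevel:
  assumes A: "band_operator A" and "0 < \<epsilon>"
  shows "pseudospectrum \<epsilon> A = {z. reciprocal_resolvent_norm A z < \<epsilon>}"
proof -
  note pair = transposed_pair_transpose_op[OF A]
  show ?thesis
    unfolding pseudospectrum_def reciprocal_resolvent_norm_def min_less_iff_disj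
      inverse_norm_greater_iff[OF transposed_pair_shift_op[OF pair] \<open>0 < \<epsilon>\<close>]
      lower_norm_less_iff[OF bounded_linear_shift_op[OF transposed_pairD(1)[OF pair]]]
      lower_norm_less_iff[OF bounded_linear_shift_op[OF transposed_pairD(2)[OF pair]]] ..
qed

text \<open>
  Whichever of the two lower norms attains the minimum at \<open>z\<close> decreases nearby, and this suffices for
  the minimum to decrease.
\<close>

lemma pseudospectral_landscape_reciprocal_resolvent_norm:
  assumes A: "band_operator A"
  shows "pseudospectral_landscape (reciprocal_resolvent_norm A)"
proof
  note pair = transposed_pair_transpose_op[OF A]
  note bl = transposed_pairD(1,2)[OF pair]
  show "continuous_on UNIV (reciprocal_resolvent_norm A)"
    unfolding reciprocal_resolvent_norm_def by (intro continuous_on_min continuous_on_lower_norm_shift bl)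
  fix c
  show "bounded {z. reciprocal_resolvent_norm A z < c}"
  proof (rule boundedI)
    fix z assume "z \<in> {z. reciprocal_resolvent_norm A z < c}"
    then show "cmod z \<le> c + max (onorm A) (onorm (transpose_op A))"
      unfolding reciprocal_resolvent_norm_def min_less_iff_disj mem_Collect_eq
      using cmod_less_if_lower_norm_less[OF bl(1), of z c] cmod_less_if_lower_norm_less[OF bl(2), of z c]
      by linarith
  qed
next
  note pair = transposed_pair_transpose_op[OF A]
  fix z and r :: real
  assume pos: "0 < reciprocal_resolvent_norm A z" and "0 < r"
  then have pos: "0 < lower_norm_on UNIV (shift_op A z)"
      "0 < lower_norm_on UNIV (shift_op (transpose_op A) z)"
    by (auto simp: reciprocal_resolvent_norm_def)
  have cl: "B (cscale c x) = cscale c (B x)" if "band_operator B" for B c x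
    using that by (simp add: band_operator_def)
  show "\<exists>w. cmod (w - z) < r \<and> reciprocal_resolvent_norm A w < reciprocal_resolvent_norm A z"
  proof (cases "lower_norm_on UNIV (shift_op A z) \<le> lower_norm_on UNIV (shift_op (transpose_op A) z)")
    case True
    then show ?thesis
      using lower_norm_shift_no_local_minimum[OF pair cl[OF A] pos \<open>0 < r\<close>]
      unfolding reciprocal_resolvent_norm_def by (auto simp: min_less_iff_disj)
  next
    case False
    then show ?thesis
      using lower_norm_shift_no_local_minimum[OF transposed_pair_commute[OF pair]
          cl[OF band_operator_transpose_op[OF A]] pos(2,1) \<open>0 < r\<close>]
      unfolding reciprocal_resolvent_norm_def by (auto simp: min_less_iff_disj)
  qed
qed

section \<open>The sandwich and its convergence\<close>

lemma pseudospectrum_cols_iff: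
  assumes B: "bounded_linear B" and "0 < d" "1 \<le> n"
  shows "z \<in> pseudospectrum_cols d \<epsilon> B n k \<longleftrightarrow>
    (\<exists>x\<in>block_window d n k. norm (shift_op B z x) < \<epsilon> * norm x)"
proof -
  have "unit_seq (k * d) \<in> block_window d n k"
    using assms(2,3) by (auto simp: block_window_def ell2_coords)
  moreover have "unit_seq (k * d) \<noteq> 0"
    using norm_unit_seq[of "k * d"] by force
  moreover have "r *\<^sub>R x \<in> block_window d n k" if "x \<in> block_window d n k" for x r
    using that by (auto simp: block_window_def ell2_coords)
  ultimately show ?thesis
    unfolding pseudospectrum_cols_def using lower_norm_on_less_iff[OF bounded_linear_shift_op[OF B]]
    by simp
qed

text \<open>
  Subtracting \<open>z\<close> changes diagonal entries only, so the off-diagonal block bounds of \<open>B\<close> serve for all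
  shifts.
\<close>

lemma lower_norm_localises:
  assumes B: "band_operator B" and "0 < d" "1 \<le> n"
    and tri: "\<And>m j. entry B m j \<noteq> 0 \<Longrightarrow> m div d \<le> Suc (j div d) \<and> j div d \<le> Suc (m div d)"
    and "0 \<le> a" and sub: "\<And>i v. L2_set (\<lambda>r. cmod (\<Sum>c<d. entry B (Suc i * d + r) (i * d + c) * v c)) {..<d}
        \<le> a * L2_set (\<lambda>c. cmod (v c)) {..<d}"
    and "0 \<le> g" and super: "\<And>i v. L2_set (\<lambda>r. cmod (\<Sum>c<d. entry B (i * d + r) (Suc i * d + c) * v c)) {..<d}
        \<le> g * L2_set (\<lambda>c. cmod (v c)) {..<d}"
    and z: "lower_norm_on UNIV (shift_op B z) < \<epsilon>"
  shows "\<exists>k. z \<in> pseudospectrum_cols d (\<epsilon> + 2 * (a + g) * sin (pi / (2 * (real n + 1)))) B n k"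
proof -
  have bl: "bounded_linear B" and cl: "\<And>c x. B (cscale c x) = cscale c (B x)"
    using B by (auto simp: band_operator_def)
  have entry: "entry (shift_op B z) m j = entry B m j" if "m \<noteq> j" for m j
    using that by (simp add: entry_def shift_op_def ell2_coords)
  have block: "entry (shift_op B z) (Suc i * d + r) (i * d + c) = entry B (Suc i * d + r) (i * d + c)"
      "entry (shift_op B z) (i * d + r) (Suc i * d + c) = entry B (i * d + r) (Suc i * d + c)"
    if "r < d" "c < d" for i r c
    using that by (auto intro!: entry)
  obtain x where x: "norm (shift_op B z x) < \<epsilon> * norm x"
    using z unfolding lower_norm_less_iff[OF bounded_linear_shift_op[OF bl]] ..
  have "\<exists>k. \<exists>y\<in>block_window d n k. norm (shift_op B z y)
      < (\<epsilon> + 2 * (a + g) * sin (pi / (2 * (real n + 1)))) * norm y"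
  proof (rule window_localisation[OF bounded_linear_shift_op[OF bl] _ \<open>0 < d\<close> _ \<open>0 \<le> a\<close> _ \<open>0 \<le> g\<close> _ \<open>1 \<le> n\<close> x])
    show "shift_op B z (cscale c x) = cscale c (shift_op B z x)" for c x
      by (simp add: shift_op_def cl cscale_algebra mult.commute)
    show "m div d \<le> Suc (j div d) \<and> j div d \<le> Suc (m div d)" if "entry (shift_op B z) m j \<noteq> 0" for m j
      using that tri entry by (cases "m = j") auto
    show "L2_set (\<lambda>r. cmod (\<Sum>c<d. entry (shift_op B z) (Suc i * d + r) (i * d + c) * v c)) {..<d}
        \<le> a * L2_set (\<lambda>c. cmod (v c)) {..<d}" for i v
    proof -
      have "L2_set (\<lambda>r. cmod (\<Sum>c<d. entry (shift_op B z) (Suc i * d + r) (i * d + c) * v c)) {..<d}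
          = L2_set (\<lambda>r. cmod (\<Sum>c<d. entry B (Suc i * d + r) (i * d + c) * v c)) {..<d}"
        by (intro L2_set_cong refl arg_cong[of _ _ cmod] sum.cong) (simp add: block del: mult_Suc)
      then show ?thesis using sub[of i v] by simp
    qed
    show "L2_set (\<lambda>r. cmod (\<Sum>c<d. entry (shift_op B z) (i * d + r) (Suc i * d + c) * v c)) {..<d}
        \<le> g * L2_set (\<lambda>c. cmod (v c)) {..<d}" for i v
    proof -
      have "L2_set (\<lambda>r. cmod (\<Sum>c<d. entry (shift_op B z) (i * d + r) (Suc i * d + c) * v c)) {..<d}
          = L2_set (\<lambda>r. cmod (\<Sum>c<d. entry B (i * d + r) (Suc i * d + c) * v c)) {..<d}"
        by (intro L2_set_cong refl arg_cong[of _ _ cmod] sum.cong) (simp add: block del: mult_Suc)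
      then show ?thesis using super[of i v] by simp
    qed
  qed
  then show ?thesis
    using pseudospectrum_cols_iff[OF bl \<open>0 < d\<close> \<open>1 \<le> n\<close>] by blast
qed

lemma window_pseudospectra_subset:
  assumes A: "band_operator A" and "1 \<le> n"
  shows "(\<Union>k. pseudospectrum_pair \<epsilon> A n k) \<subseteq> {z. reciprocal_resolvent_norm A z < \<epsilon>}"
proof -
  note bl = transposed_pairD(1,2)[OF transposed_pair_transpose_op[OF A]]
  have "lower_norm_on UNIV (shift_op B z) < \<epsilon>"
    if "bounded_linear B" "z \<in> pseudospectrum_cols (block_size A) \<epsilon> B n k" for B z k
    using that lower_norm_less_iff[OF bounded_linear_shift_op[OF that(1)]]
      pseudospectrum_cols_iff[OF that(1) block_size_pos \<open>1 \<le> n\<close>] by blast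
  then show ?thesis
    using bl unfolding pseudospectrum_pair_def reciprocal_resolvent_norm_def min_less_iff_disj by blast
qed

lemma window_pseudospectra_superset:
  assumes A: "band_operator A" and "1 \<le> n"
  shows "{z. reciprocal_resolvent_norm A z < \<epsilon>} \<subseteq> (\<Union>k. pseudospectrum_pair (\<epsilon> + eps_n A n) A n k)"
proof
  fix z assume "z \<in> {z. reciprocal_resolvent_norm A z < \<epsilon>}"
  then consider "lower_norm_on UNIV (shift_op A z) < \<epsilon>"
    | "lower_norm_on UNIV (shift_op (transpose_op A) z) < \<epsilon>"
    by (auto simp: reciprocal_resolvent_norm_def min_less_iff_disj)
  then show "z \<in> (\<Union>k. pseudospectrum_pair (\<epsilon> + eps_n A n) A n k)"
  proof cases
    case 1
    have "\<exists>k. z \<in> pseudospectrum_cols (block_size A) (\<epsilon> + eps_n A n) A n k"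
      unfolding eps_n_def
      by (rule lower_norm_localises[OF A block_size_pos \<open>1 \<le> n\<close> entry_block_tridiagonal[OF A]
            subdiag_norm_nonneg[OF A] subdiag_block_bound[OF A]
            superdiag_norm_nonneg[OF A] superdiag_block_bound[OF A] 1])
    then show ?thesis by (auto simp: pseudospectrum_pair_def)
  next
    case 2
    have "\<exists>k. z \<in> pseudospectrum_cols (block_size A)
        (\<epsilon> + 2 * (superdiag_norm A + subdiag_norm A) * sin (pi / (2 * (real n + 1)))) (transpose_op A) n k"
    proof (rule lower_norm_localises[OF band_operator_transpose_op[OF A] block_size_pos \<open>1 \<le> n\<close> _
            superdiag_norm_nonneg[OF A] _ subdiag_norm_nonneg[OF A] _ 2])
      show "m div block_size A \<le> Suc (j div block_size A) \<and> j div block_size A \<le> Suc (m div block_size A)"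
        if "entry (transpose_op A) m j \<noteq> 0" for m j
        using that entry_block_tridiagonal[OF A, of j m] by (auto simp: entry_transpose_op[OF A])
    qed (unfold entry_transpose_op[OF A],
        rule L2_set_transposed_matrix[OF superdiag_block_bound[OF A]],
        rule L2_set_transposed_matrix[OF subdiag_block_bound[OF A]])
    then have "\<exists>k. z \<in> pseudospectrum_cols (block_size A) (\<epsilon> + eps_n A n) (transpose_op A) n k"
      by (simp add: eps_n_def add.commute)
    then show ?thesis by (auto simp: pseudospectrum_pair_def)
  qed
qed

lemma pseudospectrum_pair_mono:
  "\<epsilon> \<le> \<epsilon>' \<Longrightarrow> pseudospectrum_pair \<epsilon> A n k \<subseteq> pseudospectrum_pair \<epsilon>' A n k"
  by (auto simp: pseudospectrum_pair_def pseudospectrum_cols_def)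

lemma eps_n_tendsto_0: "eps_n A \<longlonglongrightarrow> 0"
proof -
  define c where "c = 2 * (subdiag_norm A + superdiag_norm A)"
  have "(\<lambda>n. c * sin (pi / 2 * inverse (real (Suc n)))) \<longlonglongrightarrow> c * sin (pi / 2 * 0)"
    by (rule tendsto_mult_left[OF tendsto_sin[OF tendsto_mult_left[OF LIMSEQ_inverse_real_of_nat]]])
  moreover have "eps_n A = (\<lambda>n. c * sin (pi / 2 * inverse (real (Suc n))))"
  proof (rule ext)
    fix n
    have "pi / (2 * (real n + 1)) = pi / 2 * inverse (real (Suc n))"
      by (simp add: field_simps)
    then show "eps_n A n = c * sin (pi / 2 * inverse (real (Suc n)))"
      by (simp only: eps_n_def c_def)
  qed
  ultimately show ?thesis by simp
qed

theorem proposition6p1: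
  fixes A :: "ell2 \<Rightarrow> ell2"
  assumes "band_operator A"
  shows
    "(\<forall>\<epsilon>>0. \<forall>n\<ge>1.
        (\<Union>k. pseudospectrum_pair \<epsilon> A n k) \<subseteq> pseudospectrum \<epsilon> A \<and>
        pseudospectrum \<epsilon> A \<subseteq> (\<Union>k. pseudospectrum_pair (\<epsilon> + eps_n A n) A n k)) \<and>
     (\<forall>\<epsilon>>0.
        hausdorff_converges (\<lambda>n. \<Union>k. pseudospectrum_pair \<epsilon> A n k) (pseudospectrum \<epsilon> A) \<and>
        hausdorff_converges (\<lambda>n. \<Union>k. pseudospectrum_pair (\<epsilon> + eps_n A n) A n k)
          (pseudospectrum \<epsilon> A))"
proof -
  interpret pseudospectral_landscape "reciprocal_resolvent_norm A"
    by (rule pseudospectral_landscape_reciprocal_resolvent_norm[OF assms])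
  note lower = window_pseudospectra_subset[OF assms]
  note upper = window_pseudospectra_superset[OF assms]
  have "hausdorff_converges (\<lambda>n. \<Union>k. pseudospectrum_pair \<epsilon> A n k) {z. reciprocal_resolvent_norm A z < \<epsilon>}"
    if "0 < \<epsilon>" for \<epsilon>
  \<comment> \<open>A point of level below \<open>\<epsilon>\<close> also has level below some \<open>\<epsilon>' < \<epsilon>\<close>; the superset inclusion at \<open>\<epsilon>'\<close> puts
     it in the subset for \<open>\<epsilon>\<close> as soon as the error is at most \<open>\<epsilon> - \<epsilon>'\<close>.\<close>
  proof (rule hausdorff_converges_from_below[OF sublevel_nonempty[OF that] coercive lower])
    fix t assume "t \<in> {z. reciprocal_resolvent_norm A z < \<epsilon>}"
    then obtain \<epsilon>' where \<epsilon>': "reciprocal_resolvent_norm A t < \<epsilon>'" "\<epsilon>' < \<epsilon>"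
      using dense by blast
    have "\<forall>\<^sub>F n in sequentially. eps_n A n < \<epsilon> - \<epsilon>'"
      using eps_n_tendsto_0 \<epsilon>'(2) by (intro order_tendstoD) auto
    then show "\<forall>\<^sub>F n in sequentially. t \<in> (\<Union>k. pseudospectrum_pair \<epsilon> A n k)"
      using eventually_ge_at_top[of 1]
    proof eventually_elim
      case (elim n)
      obtain k where "t \<in> pseudospectrum_pair (\<epsilon>' + eps_n A n) A n k"
        using upper[OF elim(2), of \<epsilon>'] \<epsilon>'(1) by blast
      then show ?case
        using pseudospectrum_pair_mono[of "\<epsilon>' + eps_n A n" \<epsilon> A n k] elim(1) by auto
    qed
  qed
  moreover have "hausdorff_converges (\<lambda>n. \<Union>k. pseudospectrum_pair (\<epsilon> + eps_n A n) A n k)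
      {z. reciprocal_resolvent_norm A z < \<epsilon>}" if "0 < \<epsilon>" for \<epsilon>
    using that eps_n_tendsto_0 upper lower by (rule hausdorff_converges_from_above)
  ultimately show ?thesis
    using lower upper by (simp add: pseudospectrum_eq_sublevel[OF assms])
qed

end
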